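(* Consider a sequence of problems indexed by the sample size $n$: for each $n$, $(X,Y)$ is a pair of mean-zero (not necessarily independent) random vectors in $\mathbb R^{p}\times\mathbb R^{q}$, where $p=p_n$, $q=q_n$ and the law of $(X,Y)$ may depend on $n$, and $T_n$ is computed from $n$ i.i.d. copies of $(X,Y)$. Assume that $\mathbb E(\|X\|^8)+\mathbb E(\|Y\|^8)<\infty$ and that, as $n\to\infty$, $$\frac{\mathbb E\big(|d(X_1,X_2)|^{4}\big)\,\mathbb E\big(|d(Y_1,Y_2)|^{4}\big)}{n\,[\mathcal V^2(X)\mathcal V^2(Y)]^{2}}\to 0 .$$ If $n\,\mathcal R^2(X,Y)\to\infty$ and $$\frac{\sqrt n\,\mathcal V^2(X,Y)}{B_X^{-1/2}B_Y^{-1/2}L_x^{1/4}L_y^{1/4}}\to\infty,$$ then for any arbitrarily large constant $C>0$, $\mathbb P(T_n>C)\to1$ as $n\to\infty$. Thus, for any significance level $\alpha\in(0,1)$, $\mathbb P(T_n>\Phi^{-1}(1-\alpha))\to1$ as $n\to\infty$, where $\Phi^{-1}(1-\alpha)$ is the $(1-\alpha)$th quantile of the standard normal distribution.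
   Context: $\|\cdot\|$ is the Euclidean norm and $(X_1,Y_1),(X_2,Y_2),\dots$ are i.i.d. copies of $(X,Y)$; $\mathbb E[X]=0$, $\mathbb E[Y]=0$. Double-centered distance: $d(X_1,X_2)=\|X_1-X_2\|-\mathbb E[\|X_1-X_2\|\mid X_1]-\mathbb E[\|X_1-X_2\|\mid X_2]+\mathbb E\|X_1-X_2\|$, and similarly $d(Y_1,Y_2)$. Distance covariance: $\mathcal V^2(X,Y)=\mathbb E[d(X_1,X_2)d(Y_1,Y_2)]$; distance variances: $\mathcal V^2(X)=\mathcal V^2(X,X)$, $\mathcal V^2(Y)=\mathcal V^2(Y,Y)$ (assumed positive); distance correlation: $\mathcal R^2(X,Y)=\mathcal V^2(X,Y)/\sqrt{\mathcal V^2(X)\mathcal V^2(Y)}$. $B_X=\mathbb E\|X_1-X_2\|^2$, $B_Y=\mathbb E\|Y_1-Y_2\|^2$, $L_x=\mathbb E\big(\big|\|X\|^2-\mathbb E\|X\|^2\big|^4\big)+\mathbb E\big(|X_1^TX_2|^4\big)$, $L_y=\mathbb E\big(\big|\|Y\|^2-\mathbb E\|Y\|^2\big|^4\big)+\mathbb E\big(|Y_1^TY_2|^4\big)$. Sample quantities ($n\ge4$): with $a_{k,l}=\|X_k-X_l\|$, $b_{k,l}=\|Y_k-Y_l\|$, put $A^*_{k,l}=a_{k,l}-\frac1{n-2}\sum_{i=1}^n a_{i,l}-\frac1{n-2}\sum_{j=1}^n a_{k,j}+\frac{1}{(n-1)(n-2)}\sum_{i,j=1}^n a_{i,j}$, and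 $B^*_{k,l}$ in the same way from $b_{k,l}$. Set $\mathcal V_n^*(X,Y)=\frac1{n(n-3)}\sum_{1\le k\ne l\le n}A^*_{k,l}B^*_{k,l}$, $\mathcal V_n^*(X)=\mathcal V_n^*(X,X)$, $\mathcal V_n^*(Y)=\mathcal V_n^*(Y,Y)$. $\mathcal R_n^*(X,Y)=\mathcal V_n^*(X,Y)/\sqrt{\mathcal V_n^*(X)\mathcal V_n^*(Y)}$ if $\mathcal V_n^*(X)\mathcal V_n^*(Y)>0$ and $0$ otherwise. $T_n=\sqrt{n(n-1)/2}\;\mathcal R_n^*(X,Y)$. *)

theory Defs
  imports "HOL-Probability.Probability"
begin

text \<open>
  The dimensions \<open>p\<close> and \<open>q\<close> vary with the sample size, so a vector of \<open>\<real>\<^sup>p\<close> is a function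
  \<^typ>\<open>nat \<Rightarrow> real\<close> restricted to the index set \<open>{..<p}\<close>, and \<open>vec_borel p\<close> is the
  Borel sigma-algebra of \<open>\<real>\<^sup>p\<close>, as a product of Borel lines.
\<close>

type_synonym rvec = "nat \<Rightarrow> real"

abbreviation vec_borel :: "nat \<Rightarrow> rvec measure" where
  "vec_borel p \<equiv> Pi\<^sub>M {..<p} (\<lambda>_. borel)"

definition vnorm :: "nat \<Rightarrow> rvec \<Rightarrow> real" where
  "vnorm p x = L2_set x {..<p}"

definition vinner :: "nat \<Rightarrow> rvec \<Rightarrow> rvec \<Rightarrow> real" where
  "vinner p x y = (\<Sum>j<p. x j * y j)"

definition vdist :: "nat \<Rightarrow> rvec \<Rightarrow> rvec \<Rightarrow> real" where
  "vdist p x y = vnorm p (\<lambda>j. x j - y j)"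

definition iid_copies ::
  "'a measure \<Rightarrow> 'b measure \<Rightarrow> ('a \<Rightarrow> 'b) \<Rightarrow> nat set \<Rightarrow> (nat \<Rightarrow> 'a \<Rightarrow> 'b) \<Rightarrow> bool" where
  "iid_copies M N Z I Zs \<longleftrightarrow>
     prob_space.indep_vars M (\<lambda>_. N) Zs I \<and> (\<forall>i\<in>I. distr M N (Zs i) = distr M N Z)"


text \<open>
  Population quantities. The argument \<open>X\<close> (or \<open>Y\<close>) of the following definitions is a sequence
  of i.i.d. copies, of which the members with index 1 and 2 are used.
\<close>

definition cond_exp_given ::
  "'a measure \<Rightarrow> nat \<Rightarrow> ('a \<Rightarrow> rvec) \<Rightarrow> ('a \<Rightarrow> real) \<Rightarrow> 'a \<Rightarrow> real" where
  "cond_exp_given M p Z f = real_cond_exp M (vimage_algebra (space M) Z (vec_borel p)) f"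

definition ddist :: "'a measure \<Rightarrow> nat \<Rightarrow> (nat \<Rightarrow> 'a \<Rightarrow> rvec) \<Rightarrow> 'a \<Rightarrow> real" where
  "ddist M p X \<omega> =
     (let D = (\<lambda>\<omega>. vdist p (X 1 \<omega>) (X 2 \<omega>)) in
      D \<omega> - cond_exp_given M p (X 1) D \<omega> - cond_exp_given M p (X 2) D \<omega> + integral\<^sup>L M D)"

definition dcov2 ::
  "'a measure \<Rightarrow> nat \<Rightarrow> nat \<Rightarrow> (nat \<Rightarrow> 'a \<Rightarrow> rvec) \<Rightarrow> (nat \<Rightarrow> 'a \<Rightarrow> rvec) \<Rightarrow> real" where
  "dcov2 M p q X Y = (\<integral>\<omega>. ddist M p X \<omega> * ddist M q Y \<omega> \<partial>M)"

definition dvar2 :: "'a measure \<Rightarrow> nat \<Rightarrow> (nat \<Rightarrow> 'a \<Rightarrow> rvec) \<Rightarrow> real" where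
  "dvar2 M p X = dcov2 M p p X X"

definition dcor2 ::
  "'a measure \<Rightarrow> nat \<Rightarrow> nat \<Rightarrow> (nat \<Rightarrow> 'a \<Rightarrow> rvec) \<Rightarrow> (nat \<Rightarrow> 'a \<Rightarrow> rvec) \<Rightarrow> real" where
  "dcor2 M p q X Y = dcov2 M p q X Y / sqrt (dvar2 M p X * dvar2 M q Y)"

definition ddist_moment4 :: "'a measure \<Rightarrow> nat \<Rightarrow> (nat \<Rightarrow> 'a \<Rightarrow> rvec) \<Rightarrow> real" where
  "ddist_moment4 M p X = (\<integral>\<omega>. \<bar>ddist M p X \<omega>\<bar> ^ 4 \<partial>M)"

definition B_const :: "'a measure \<Rightarrow> nat \<Rightarrow> (nat \<Rightarrow> 'a \<Rightarrow> rvec) \<Rightarrow> real" where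
  "B_const M p X = (\<integral>\<omega>. (vdist p (X 1 \<omega>) (X 2 \<omega>))\<^sup>2 \<partial>M)"

text \<open>Here \<open>X0\<close> is the generic vector and \<open>X\<close> the sequence of its copies.\<close>

definition L_const ::
  "'a measure \<Rightarrow> nat \<Rightarrow> ('a \<Rightarrow> rvec) \<Rightarrow> (nat \<Rightarrow> 'a \<Rightarrow> rvec) \<Rightarrow> real" where
  "L_const M p X0 X =
     (\<integral>\<omega>. \<bar>(vnorm p (X0 \<omega>))\<^sup>2 - (\<integral>\<omega>'. (vnorm p (X0 \<omega>'))\<^sup>2 \<partial>M)\<bar> ^ 4 \<partial>M)
     + (\<integral>\<omega>. \<bar>vinner p (X 1 \<omega>) (X 2 \<omega>)\<bar> ^ 4 \<partial>M)"


text \<open>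
  Sample quantities, as functions of the \<open>n \<times> n\<close> matrices of pairwise distances
  (indexed from 1); they are meaningful for \<open>n \<ge> 4\<close>.
\<close>

definition ucenter :: "nat \<Rightarrow> (nat \<Rightarrow> nat \<Rightarrow> real) \<Rightarrow> nat \<Rightarrow> nat \<Rightarrow> real" where
  "ucenter n a k l =
     a k l
     - 1 / (real n - 2) * (\<Sum>i=1..n. a i l)
     - 1 / (real n - 2) * (\<Sum>j=1..n. a k j)
     + 1 / ((real n - 1) * (real n - 2)) * (\<Sum>i=1..n. \<Sum>j=1..n. a i j)"

definition sample_dcov :: "nat \<Rightarrow> (nat \<Rightarrow> nat \<Rightarrow> real) \<Rightarrow> (nat \<Rightarrow> nat \<Rightarrow> real) \<Rightarrow> real" where
  "sample_dcov n a b =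
     1 / (real n * (real n - 3)) *
     (\<Sum>k=1..n. \<Sum>l\<in>{1..n} - {k}. ucenter n a k l * ucenter n b k l)"

definition sample_dcor :: "nat \<Rightarrow> (nat \<Rightarrow> nat \<Rightarrow> real) \<Rightarrow> (nat \<Rightarrow> nat \<Rightarrow> real) \<Rightarrow> real" where
  "sample_dcor n a b =
     (if sample_dcov n a a * sample_dcov n b b > 0
      then sample_dcov n a b / sqrt (sample_dcov n a a * sample_dcov n b b) else 0)"

definition T_stat ::
  "nat \<Rightarrow> nat \<Rightarrow> nat \<Rightarrow> (nat \<Rightarrow> 'a \<Rightarrow> rvec) \<Rightarrow> (nat \<Rightarrow> 'a \<Rightarrow> rvec) \<Rightarrow> 'a \<Rightarrow> real" where
  "T_stat n p q X Y \<omega> =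
     sqrt (real n * (real n - 1) / 2) *
     sample_dcor n (\<lambda>k l. vdist p (X k \<omega>) (X l \<omega>)) (\<lambda>k l. vdist q (Y k \<omega>) (Y l \<omega>))"

definition std_normal_quantile :: "real \<Rightarrow> real" where
  "std_normal_quantile u = Inf {x. u \<le> cdf std_normal_distribution x}"

end

theory Submission
  imports Defs
begin

text \<open>
  Off the diagonal, U-centring does not see additive row and column effects, so the distances in
  the sample statistics may be replaced by the doubly centred kernels \<open>h\<close>, \<open>e\<close> of \<open>X\<close>, \<open>Y\<close>.
  With row sums \<open>r\<^sub>k\<close>, \<open>t\<^sub>k\<close> of the two matrices and their totals \<open>s\<close>, \<open>u\<close>, the
  sample covariance is \<open>\<Sum>h e - 2/(n-2) \<Sum>r\<^sub>k t\<^sub>k + s u/((n-1)(n-2))\<close> up to the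
  factor \<open>n(n-3)\<close>. Products over disjoint index pairs are independent and only \<open>O(n\<^sup>3)\<close> pairs of
  index pairs overlap, while degeneracy of \<open>h\<close> and \<open>e\<close> makes the row sums of order
  \<open>sqrt n\<close>. Hence the sample covariance is within \<open>O((E h\<^sup>4 E e\<^sup>4)\<^bsup>1/4\<^esup> / sqrt n)\<close> of the
  population covariance in mean. For the two variances this error is relatively small by the
  moment ratio condition, as both \<open>E h\<^sup>4 / (E h\<^sup>2)\<^sup>2\<close> and \<open>E e\<^sup>4 / (E e\<^sup>2)\<^sup>2\<close> are at least one; for
  the covariance it is so because \<open>E h\<^sup>4 \<le> K L / B\<^sup>2\<close>. On the event that the three statistics are close to their targets,
  \<open>T\<^sub>n \<ge> n R\<^sup>2 / 6\<close>.
\<close>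

section \<open>U-centring\<close>

text \<open>\<open>X\<close> and \<open>Y\<close> may be dependent, so the products h e need not be
  degenerate even though h and e are: their centred sum can fluctuate at order n^(3/2), and this is
  the dominant error. Every correction coming from the row sums is O(n) in mean before the division
  by n(n-3). Measuring the error in mean rather than in mean square lets second moments of the row
  sums suffice; a mean-square bound on their products would call for fourth moments of the sums.
  Both kernels are treated as functions on points of the joint law, each looking at one coordinate
  only, so that a single i.i.d. sample carries the covariance and both variances. Since laws and
  dimensions change with n, all estimates are made at one fixed n with explicit constants, and
  limits are taken only at the very end. The two signal conditions have separate duties: the second
  makes the error of the sample covariance small relative to the covariance, the first lifts the
  resulting lower bound for the statistic above C.\<close>

lemma sum_swap_sym:
  fixes a :: "'i \<Rightarrow> 'i \<Rightarrow> real"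
  assumes "\<And>k l. a k l = a l k"
  shows "(\<Sum>i\<in>I. a i l) = (\<Sum>i\<in>I. a l i)"
  by (rule sum.cong) (auto simp: assms)

lemma ucenter_sym:
  fixes a :: "nat \<Rightarrow> nat \<Rightarrow> real"
  assumes "\<And>k l. a k l = a l k"
  shows "ucenter n a k l = a k l - ((\<Sum>i=1..n. a k i) + (\<Sum>i=1..n. a l i)) / (real n - 2)
    + (\<Sum>i=1..n. \<Sum>j=1..n. a i j) / ((real n - 1) * (real n - 2))"
  unfolding ucenter_def sum_swap_sym[where a = a, OF assms] by (simp add: add_divide_distrib)

text \<open>The weights 1/(n-2) and 1/((n-1)(n-2)) are matched to a zero diagonal. As
  \<open>d\<close> vanishes there instead of following the formula, row k carries its own effect
  \<open>g k\<close> only n-2 times and the constant n-1 times; with these counts all effects cancel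
  at every off-diagonal entry.\<close>

lemma ucenter_double_centering:
  fixes a d :: "nat \<Rightarrow> nat \<Rightarrow> real"
  assumes n: "n \<ge> 4" and sym: "\<And>k l. a k l = a l k"
    and d: "\<And>k l. d k l = (if k = l then 0 else a k l - g k - g l + c)"
    and diag: "\<And>k. a k k = 0"
    and kl: "k \<in> {1..n}" "l \<in> {1..n}" "k \<noteq> l"
  shows "ucenter n d k l = ucenter n a k l"
proof -
  have symd: "d k l = d l k" for k l using d sym by simp
  define G where "G = (\<Sum>i=1..n. g i)"
  have row: "(\<Sum>i=1..n. d k i) = (\<Sum>i=1..n. a k i) - (real n - 2) * g k - G + (real n - 1) * c"
    if "k \<in> {1..n}" for k
  proof -
    \<comment> \<open>The off-diagonal formula is extended to i = k, where it would give c - 2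
      \<open>g k\<close> instead of 0; the last summand is this correction.\<close>
    have "(\<Sum>i=1..n. d k i) = (\<Sum>i=1..n. (a k i - g k - g i + c) + (if i = k then 2 * g k - c else 0))"
      by (rule sum.cong) (auto simp: d diag)
    also have "\<dots> = (\<Sum>i=1..n. a k i) - real n * g k - G + real n * c + 2 * g k - c"
      using that by (simp add: sum.distrib sum_subtractf G_def)
    finally show ?thesis by (simp add: algebra_simps)
  qed
  have "(\<Sum>i=1..n. \<Sum>j=1..n. d i j)
    = (\<Sum>i=1..n. (\<Sum>j=1..n. a i j) - (real n - 2) * g i - G + (real n - 1) * c)"
    by (intro sum.cong refl row)
  also have "\<dots> = (\<Sum>i=1..n. \<Sum>j=1..n. a i j) - (real n - 2) * G - real n * G + real n * (real n - 1) * c"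
    by (simp add: sum.distrib sum_subtractf G_def sum_distrib_left algebra_simps)
  finally have tot: "(\<Sum>i=1..n. \<Sum>j=1..n. d i j)
    = (\<Sum>i=1..n. \<Sum>j=1..n. a i j) - 2 * (real n - 1) * G + real n * (real n - 1) * c"
    by (simp add: algebra_simps)
  have p: "real n - 1 \<noteq> 0" "real n - 2 \<noteq> 0" using n by auto
  define m where "m = real n - 2"
  define T where "T = (\<Sum>i=1..n. \<Sum>j=1..n. a i j)"
  have m: "m \<noteq> 0" "real n = m + 2" using p by (auto simp: m_def)
  have 1: "(T - 2 * (real n - 1) * G + real n * (real n - 1) * c) / ((real n - 1) * m)
    = T / ((real n - 1) * m) - 2 * G / m + real n * c / m"
  proof -
    have "(T - 2 * z * G + real n * z * c) / (z * m) = T / (z * m) - 2 * G / m + real n * c / m"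
      if "z \<noteq> 0" for z
      using that m(1) by (simp add: field_simps)
    then show ?thesis using p(1) by blast
  qed
  have 2: "(x - m * g k - G + (real n - 1) * c + (y - m * g l - G + (real n - 1) * c)) / m
    = (x + y) / m - g k - g l - 2 * G / m + 2 * (real n - 1) * c / m" for x y
    using m(1) by (simp add: field_simps)
  \<comment> \<open>What is left of the constant: with n = m + 2 the coefficients add up to (m -
    2(m+1) + (m+2))/m = 0.\<close>
  have 3: "c - 2 * (real n - 1) * c / m + real n * c / m = 0"
    using m(1) unfolding m(2) by (simp add: field_simps)
  show ?thesis
    unfolding ucenter_sym[of d, OF symd] ucenter_sym[of a, OF sym] tot row[OF kl(1)] row[OF kl(2)]
      T_def[symmetric] m_def[symmetric] 1 2
    using 3 kl(3) by (simp add: d)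
qed

lemma sample_dcov_double_centering:
  fixes a b d e :: "nat \<Rightarrow> nat \<Rightarrow> real"
  assumes n: "n \<ge> 4" and "\<And>k l. a k l = a l k" "\<And>k l. b k l = b l k" "\<And>k. a k k = 0" "\<And>k. b k k = 0"
    and "\<And>k l. d k l = (if k = l then 0 else a k l - g k - g l + c)"
    and "\<And>k l. e k l = (if k = l then 0 else b k l - g' k - g' l + c')"
  shows "sample_dcov n a b = sample_dcov n d e"
  unfolding sample_dcov_def
  by (intro arg_cong2[where f = "(*)"] sum.cong refl)
     (auto simp: ucenter_double_centering[OF n assms(2) assms(6) assms(4)]
        ucenter_double_centering[OF n assms(3) assms(7) assms(5)])

text \<open>The off-diagonal row sums of a U-centred matrix vanish, so it is orthogonal to row
  effects, column effects and constants. One of the two centrings in the product can therefore be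
  dropped, which leaves raw entries and a single set of row-sum corrections.\<close>

lemma sample_dcov_expand:
  fixes a b :: "nat \<Rightarrow> nat \<Rightarrow> real"
  assumes n: "n \<ge> 4" and sym: "\<And>k l. a k l = a l k" "\<And>k l. b k l = b l k"
    and diag: "\<And>k. a k k = 0" "\<And>k. b k k = 0"
  defines "r \<equiv> \<lambda>k. \<Sum>l=1..n. a k l" and "t \<equiv> \<lambda>k. \<Sum>l=1..n. b k l"
  shows "sample_dcov n a b = ((\<Sum>k=1..n. \<Sum>l=1..n. a k l * b k l)
      - 2 / (real n - 2) * (\<Sum>k=1..n. r k * t k)
      + (\<Sum>k=1..n. r k) * (\<Sum>k=1..n. t k) / ((real n - 1) * (real n - 2))) / (real n * (real n - 3))"
proof -
  define m where "m = real n - 2"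
  define s where "s = (\<Sum>k=1..n. r k) / ((real n - 1) * m)"
  define u where "u = (\<Sum>k=1..n. t k) / ((real n - 1) * m)"
  have p: "real n - 1 \<noteq> 0" "m \<noteq> 0" using n by (auto simp: m_def)
  have S: "(\<Sum>k=1..n. r k) = s * (real n - 1) * m" "(\<Sum>k=1..n. t k) = u * (real n - 1) * m"
    using p by (auto simp: s_def u_def)
  have ua: "ucenter n a k l = a k l - (r k + r l) / m + s" for k l
    unfolding ucenter_sym[of a, OF sym(1)] r_def s_def m_def by simp
  have ub: "ucenter n b k l = b k l - (t k + t l) / m + u" for k l
    unfolding ucenter_sym[of b, OF sym(2)] t_def u_def m_def by simp
  have off: "(\<Sum>l\<in>{1..n}-{k}. f l) = (\<Sum>l=1..n. f l) - f k" if "k \<in> {1..n}" for k and f :: "nat \<Rightarrow> real"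
    using that by (simp add: sum_diff1)
  \<comment> \<open>The formula of \<open>ucenter\<close> gives -2 \<open>r k\<close> / m + s on the
    diagonal, not 0; the row sum vanishes only after this entry is removed.\<close>
  have row0: "(\<Sum>l\<in>{1..n}-{k}. ucenter n a k l) = 0" if "k \<in> {1..n}" for k
  proof -
    have "(\<Sum>l=1..n. ucenter n a k l) = r k - (real n * r k + s * (real n - 1) * m) / m + real n * s"
      unfolding ua sum.distrib sum_subtractf sum_divide_distrib[symmetric] S(1)[symmetric]
      by (simp add: r_def)
    moreover have "ucenter n a k k = - 2 * r k / m + s" by (simp add: ua diag)
    moreover have "(real n * r k + s * (real n - 1) * m) / m = r k + 2 * r k / m + s * (real n - 1)"
      using p(2) by (simp add: field_simps) (simp add: m_def algebra_simps)
    ultimately show ?thesis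
      unfolding off[OF that] by (simp add: algebra_simps)
  qed
  have row0': "(\<Sum>k=1..n. \<Sum>l\<in>{1..n}-{k}. ucenter n a k l * f k) = 0" for f
    by (rule sum.neutral, rule ballI) (simp only: sum_distrib_right[symmetric] row0 mult_zero_left)
  have "(\<Sum>k=1..n. \<Sum>l\<in>{1..n}-{k}. ucenter n a k l * ucenter n b k l)
    = (\<Sum>k=1..n. \<Sum>l\<in>{1..n}-{k}. ucenter n a k l * b k l)
      - (\<Sum>k=1..n. \<Sum>l\<in>{1..n}-{k}. ucenter n a k l * (t k / m))
      - (\<Sum>k=1..n. \<Sum>l\<in>{1..n}-{k}. ucenter n a k l * (t l / m))
      + (\<Sum>k=1..n. \<Sum>l\<in>{1..n}-{k}. ucenter n a k l * u)"
    unfolding sum.distrib[symmetric] sum_subtractf[symmetric] ub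
    by (intro sum.cong refl) (simp add: field_simps add_divide_distrib)
  also have "(\<Sum>k=1..n. \<Sum>l\<in>{1..n}-{k}. ucenter n a k l * (t k / m)) = 0"
    by (rule row0')
  also have "(\<Sum>k=1..n. \<Sum>l\<in>{1..n}-{k}. ucenter n a k l * u) = 0"
    by (rule row0')
  \<comment> \<open>Interchanging the sums, with the diagonal taken out on both sides, turns the
    column effect into a row effect of a symmetric matrix, which \<open>row0'\<close>
    covers.\<close>
  also have "(\<Sum>k=1..n. \<Sum>l\<in>{1..n}-{k}. ucenter n a k l * (t l / m)) = 0"
  proof -
    have "(\<Sum>k=1..n. \<Sum>l\<in>{1..n}-{k}. ucenter n a k l * (t l / m))
      = (\<Sum>k=1..n. (\<Sum>l=1..n. ucenter n a k l * (t l / m)) - ucenter n a k k * (t k / m))"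
      by (intro sum.cong refl off)
    also have "\<dots> = (\<Sum>l=1..n. (\<Sum>k=1..n. ucenter n a k l * (t l / m)) - ucenter n a l l * (t l / m))"
      unfolding sum_subtractf by (subst sum.swap) (rule refl)
    also have "\<dots> = (\<Sum>l=1..n. \<Sum>k\<in>{1..n}-{l}. ucenter n a k l * (t l / m))"
      by (intro sum.cong refl off[symmetric])
    also have "\<dots> = (\<Sum>l=1..n. \<Sum>k\<in>{1..n}-{l}. ucenter n a l k * (t l / m))"
      by (intro sum.cong refl) (simp add: ua sym(1) add.commute)
    also have "\<dots> = 0" by (rule row0')
    finally show ?thesis .
  qed
  \<comment> \<open>The diagonal may be put back because \<open>b\<close> vanishes on it.\<close>
  also have "(\<Sum>k=1..n. \<Sum>l\<in>{1..n}-{k}. ucenter n a k l * b k l)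
    = (\<Sum>k=1..n. \<Sum>l=1..n. ucenter n a k l * b k l)"
    by (rule sum.cong[OF refl], rule off[THEN trans]) (simp_all add: diag)
  also have "\<dots> = (\<Sum>k=1..n. \<Sum>l=1..n. a k l * b k l) - (\<Sum>k=1..n. \<Sum>l=1..n. r k / m * b k l)
      - (\<Sum>k=1..n. \<Sum>l=1..n. r l / m * b k l) + (\<Sum>k=1..n. \<Sum>l=1..n. s * b k l)"
    unfolding sum.distrib[symmetric] sum_subtractf[symmetric] ua
    by (intro sum.cong refl) (simp add: field_simps add_divide_distrib)
  also have "(\<Sum>k=1..n. \<Sum>l=1..n. r l / m * b k l) = (\<Sum>k=1..n. \<Sum>l=1..n. r k / m * b k l)"
    by (subst sum.swap) (simp add: sym(2))
  also have "(\<Sum>k=1..n. \<Sum>l=1..n. r k / m * b k l) = (\<Sum>k=1..n. r k * t k) / m"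
    by (simp add: t_def sum_divide_distrib sum_distrib_left)
  also have "(\<Sum>k=1..n. \<Sum>l=1..n. s * b k l) = s * (\<Sum>k=1..n. t k)"
    by (simp add: t_def flip: sum_distrib_left)
  finally show ?thesis
    unfolding sample_dcov_def s_def m_def by (simp add: field_simps)
qed

lemma sample_dcov_scale:
  "sample_dcov n (\<lambda>k l. x * a k l) (\<lambda>k l. y * b k l) = x * y * sample_dcov n a b"
proof -
  have u: "ucenter n (\<lambda>k l. x * a k l) = (\<lambda>k l. x * ucenter n a k l)" for x a
    by (intro ext) (simp add: ucenter_def algebra_simps flip: sum_distrib_left)
  show ?thesis unfolding sample_dcov_def u by (simp add: sum_distrib_left mult_ac)
qed

section \<open>Degenerate kernels of an i.i.d. sample\<close>

text \<open>The integral is required to vanish at every point and not just almost everywhere, so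
  that it can be used pointwise under an outer integral. Fourth moments make the product of two such
  kernels square integrable.\<close>

definition degenerate_kernel :: "'b measure \<Rightarrow> ('b \<times> 'b \<Rightarrow> real) \<Rightarrow> bool" where
  "degenerate_kernel \<mu> h \<longleftrightarrow>
     integrable (\<mu> \<Otimes>\<^sub>M \<mu>) (\<lambda>z. h z ^ 4) \<and> h \<in> borel_measurable (\<mu> \<Otimes>\<^sub>M \<mu>) \<and>
     (\<forall>x y. h (x, y) = h (y, x)) \<and> (\<forall>x\<in>space \<mu>. (\<integral>y. h (x, y) \<partial>\<mu>) = 0)"

lemma degenerate_kernelD:
  assumes "degenerate_kernel \<mu> h"
  shows "integrable (\<mu> \<Otimes>\<^sub>M \<mu>) (\<lambda>z. h z ^ 4)" "h \<in> borel_measurable (\<mu> \<Otimes>\<^sub>M \<mu>)"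
    "h (x, y) = h (y, x)" "x \<in> space \<mu> \<Longrightarrow> (\<integral>y. h (x, y) \<partial>\<mu>) = 0"
  using assms by (auto simp: degenerate_kernel_def)

section \<open>Elementary moment inequalities\<close>

lemma integral_double_sum:
  fixes f :: "'i \<Rightarrow> 'j \<Rightarrow> 'a \<Rightarrow> real"
  assumes "\<And>k l. k \<in> I \<Longrightarrow> l \<in> J \<Longrightarrow> integrable M (f k l)"
  shows "(\<integral>x. (\<Sum>k\<in>I. \<Sum>l\<in>J. f k l x) \<partial>M) = (\<Sum>k\<in>I. \<Sum>l\<in>J. \<integral>x. f k l x \<partial>M)"
proof -
  have "(\<integral>x. (\<Sum>k\<in>I. \<Sum>l\<in>J. f k l x) \<partial>M) = (\<Sum>k\<in>I. \<integral>x. (\<Sum>l\<in>J. f k l x) \<partial>M)"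
    by (intro Bochner_Integration.integral_sum Bochner_Integration.integrable_sum assms)
  also have "\<dots> = (\<Sum>k\<in>I. \<Sum>l\<in>J. \<integral>x. f k l x \<partial>M)"
    by (intro sum.cong refl Bochner_Integration.integral_sum assms)
  finally show ?thesis .
qed

lemma abs_mult_le_half_squares: "\<bar>x * y\<bar> \<le> (x\<^sup>2 + y\<^sup>2) / 2" for x y :: real
proof -
  have "0 \<le> (\<bar>x\<bar> - \<bar>y\<bar>)\<^sup>2" by simp
  also have "\<dots> = x\<^sup>2 + y\<^sup>2 - 2 * \<bar>x * y\<bar>" by (simp add: power2_diff abs_mult)
  finally show ?thesis by simp
qed

lemma square_le_half_fourth: "x\<^sup>2 \<le> (1 + x ^ 4) / 2" for x :: real
  using abs_mult_le_half_squares[of 1 "x\<^sup>2"] by simp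

lemma integrable_mult_of_squares:
  fixes f g :: "'a \<Rightarrow> real"
  assumes "integrable M (\<lambda>x. (f x)\<^sup>2)" "integrable M (\<lambda>x. (g x)\<^sup>2)"
    and [measurable]: "f \<in> borel_measurable M" "g \<in> borel_measurable M"
  shows "integrable M (\<lambda>x. f x * g x)"
proof (rule Bochner_Integration.integrable_bound)
  show "integrable M (\<lambda>x. ((f x)\<^sup>2 + (g x)\<^sup>2) / 2)"
    using assms by auto
  show "AE x in M. norm (f x * g x) \<le> norm (((f x)\<^sup>2 + (g x)\<^sup>2) / 2)"
    using abs_mult_le_half_squares by auto
qed measurable

lemma (in finite_measure) integrable_square_of_fourth:
  fixes f :: "'a \<Rightarrow> real"
  assumes "integrable M (\<lambda>x. f x ^ 4)" and [measurable]: "f \<in> borel_measurable M"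
  shows "integrable M (\<lambda>x. (f x)\<^sup>2)"
proof (rule Bochner_Integration.integrable_bound)
  show "integrable M (\<lambda>x. (1 + f x ^ 4) / 2)"
    using assms by auto
  show "AE x in M. norm ((f x)\<^sup>2) \<le> norm ((1 + f x ^ 4) / 2)"
    using square_le_half_fourth by auto
qed measurable

text \<open>The arithmetic-geometric mean inequality stands in for Cauchy-Schwarz. For factors of
  second moment at most 1 both give the bound 1, and the homogeneous form is recovered afterwards by
  rescaling the kernels.\<close>

lemma integral_abs_mult_le:
  fixes f g :: "'a \<Rightarrow> real"
  assumes "integrable M (\<lambda>x. (f x)\<^sup>2)" "integrable M (\<lambda>x. (g x)\<^sup>2)"
    and [measurable]: "f \<in> borel_measurable M" "g \<in> borel_measurable M"
  shows "(\<integral>x. \<bar>f x * g x\<bar> \<partial>M) \<le> ((\<integral>x. (f x)\<^sup>2 \<partial>M) + (\<integral>x. (g x)\<^sup>2 \<partial>M)) / 2"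
proof -
  have "(\<integral>x. \<bar>f x * g x\<bar> \<partial>M) \<le> (\<integral>x. ((f x)\<^sup>2 + (g x)\<^sup>2) / 2 \<partial>M)"
    using assms by (intro integral_mono integrable_abs integrable_mult_of_squares abs_mult_le_half_squares) auto
  also have "\<dots> = ((\<integral>x. (f x)\<^sup>2 \<partial>M) + (\<integral>x. (g x)\<^sup>2 \<partial>M)) / 2"
    using assms by simp
  finally show ?thesis .
qed

text \<open>\<open>\<mu>\<close> is at once the common law and the measurable space of the
  observations, so integrals of kernels over the product measure are expectations over two sample
  members.\<close>

locale iid_sample = prob_space M for M :: "'a measure" +
  fixes Z :: "nat \<Rightarrow> 'a \<Rightarrow> 'b" and \<mu> :: "'b measure" and n :: nat
  assumes indep: "indep_vars (\<lambda>_. \<mu>) Z {1..n}"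
    and distr_Z: "\<And>i. i \<in> {1..n} \<Longrightarrow> distr M \<mu> (Z i) = \<mu>"
    and prob_mu: "prob_space \<mu>"
begin

sublocale mu: prob_space \<mu> by (rule prob_mu)
sublocale mu2: pair_prob_space \<mu> \<mu> ..

lemma measurable_Z [measurable]: "i \<in> {1..n} \<Longrightarrow> Z i \<in> measurable M \<mu>"
  using indep by (auto simp: indep_vars_def)

section \<open>Independence and joint laws inside the sample\<close>

lemma indep_var_blocks:
  assumes "A \<inter> B = {}" "A \<subseteq> {1..n}" "B \<subseteq> {1..n}"
    and "f \<in> measurable (\<Pi>\<^sub>M i\<in>A. \<mu>) P" "g \<in> measurable (\<Pi>\<^sub>M i\<in>B. \<mu>) Q"
  shows "indep_var P (\<lambda>\<omega>. f (\<lambda>i\<in>A. Z i \<omega>)) Q (\<lambda>\<omega>. g (\<lambda>i\<in>B. Z i \<omega>))"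
  using indep_var_compose[OF indep_var_restrict[OF indep assms(1-3)] assms(4-5)]
  by (simp add: comp_def)

lemma indep_var_pair:
  assumes "k \<in> {1..n}" "l \<in> {1..n}" "k \<noteq> l"
  shows "indep_var \<mu> (Z k) \<mu> (Z l)"
  using indep_var_blocks[of "{k}" "{l}" "\<lambda>x. x k" \<mu> "\<lambda>x. x l" \<mu>] assms by simp

lemma indep_var_pair_pair:
  assumes "{k, l} \<subseteq> {1..n}" "{k', l'} \<subseteq> {1..n}" "{k, l} \<inter> {k', l'} = {}"
  shows "indep_var (\<mu> \<Otimes>\<^sub>M \<mu>) (\<lambda>\<omega>. (Z k \<omega>, Z l \<omega>)) (\<mu> \<Otimes>\<^sub>M \<mu>) (\<lambda>\<omega>. (Z k' \<omega>, Z l' \<omega>))"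
  using indep_var_blocks[of "{k, l}" "{k', l'}" "\<lambda>x. (x k, x l)" "\<mu> \<Otimes>\<^sub>M \<mu>" "\<lambda>x. (x k', x l')" "\<mu> \<Otimes>\<^sub>M \<mu>"]
    assms by simp

lemma distr_pair:
  assumes "k \<in> {1..n}" "l \<in> {1..n}" "k \<noteq> l"
  shows "distr M (\<mu> \<Otimes>\<^sub>M \<mu>) (\<lambda>\<omega>. (Z k \<omega>, Z l \<omega>)) = \<mu> \<Otimes>\<^sub>M \<mu>"
  using indep_var_pair[OF assms] distr_Z assms by (simp add: indep_var_distribution_eq)

lemma measurable_Z_pair [measurable]:
  assumes "k \<in> {1..n}" "l \<in> {1..n}"
  shows "(\<lambda>\<omega>. (Z k \<omega>, Z l \<omega>)) \<in> measurable M (\<mu> \<Otimes>\<^sub>M \<mu>)"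
  using assms by measurable

lemma
  fixes f :: "'b \<times> 'b \<Rightarrow> real"
  assumes kl: "k \<in> {1..n}" "l \<in> {1..n}" "k \<noteq> l" and f: "f \<in> borel_measurable (\<mu> \<Otimes>\<^sub>M \<mu>)"
  shows integrable_pair: "integrable M (\<lambda>\<omega>. f (Z k \<omega>, Z l \<omega>)) \<longleftrightarrow> integrable (\<mu> \<Otimes>\<^sub>M \<mu>) f"
    and expectation_pair: "expectation (\<lambda>\<omega>. f (Z k \<omega>, Z l \<omega>)) = (\<integral>z. f z \<partial>(\<mu> \<Otimes>\<^sub>M \<mu>))"
  using integrable_distr_eq[OF measurable_Z_pair[OF kl(1,2)] f]
    integral_distr[OF measurable_Z_pair[OF kl(1,2)] f] distr_pair[OF kl] by simp_all

text \<open>The diagonal is set to 0 as in a distance matrix: after double centring h (z, z) is in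
  general not 0, and (Z k, Z k) does not have the product law.\<close>

definition kernel_at :: "('b \<times> 'b \<Rightarrow> real) \<Rightarrow> nat \<Rightarrow> nat \<Rightarrow> 'a \<Rightarrow> real" where
  "kernel_at h k l \<omega> = (if k = l then 0 else h (Z k \<omega>, Z l \<omega>))"

lemma measurable_kernel_at [measurable]:
  assumes "degenerate_kernel \<mu> h" "k \<in> {1..n}" "l \<in> {1..n}"
  shows "kernel_at h k l \<in> borel_measurable M"
proof -
  have [measurable]: "h \<in> borel_measurable (\<mu> \<Otimes>\<^sub>M \<mu>)"
    using assms by (simp add: degenerate_kernel_def)
  show ?thesis
    unfolding kernel_at_def[abs_def] using assms by measurable
qed

lemma
  assumes h: "degenerate_kernel \<mu> h" "(\<integral>z. h z ^ 4 \<partial>(\<mu> \<Otimes>\<^sub>M \<mu>)) \<le> 1"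
    and kl: "k \<in> {1..n}" "l \<in> {1..n}"
  shows integrable_kernel_at4: "integrable M (\<lambda>\<omega>. kernel_at h k l \<omega> ^ 4)"
    and expectation_kernel_at4: "expectation (\<lambda>\<omega>. kernel_at h k l \<omega> ^ 4) \<le> 1"
    and integrable_kernel_at2: "integrable M (\<lambda>\<omega>. (kernel_at h k l \<omega>)\<^sup>2)"
    and expectation_kernel_at2: "expectation (\<lambda>\<omega>. (kernel_at h k l \<omega>)\<^sup>2) \<le> 1"
proof -
  note [measurable] = measurable_kernel_at[OF h(1) kl]
  have m: "(\<lambda>z. h z ^ 4) \<in> borel_measurable (\<mu> \<Otimes>\<^sub>M \<mu>)"
    using degenerate_kernelD(2)[OF h(1)] by measurable
  show i: "integrable M (\<lambda>\<omega>. kernel_at h k l \<omega> ^ 4)"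
    and e: "expectation (\<lambda>\<omega>. kernel_at h k l \<omega> ^ 4) \<le> 1"
    using integrable_pair[OF kl _ m] expectation_pair[OF kl _ m] h
    by (cases "k = l"; simp add: kernel_at_def degenerate_kernel_def)+
  show i2: "integrable M (\<lambda>\<omega>. (kernel_at h k l \<omega>)\<^sup>2)"
    by (rule integrable_square_of_fourth[OF i]) measurable
  have "expectation (\<lambda>\<omega>. (kernel_at h k l \<omega>)\<^sup>2) \<le> expectation (\<lambda>\<omega>. (1 + kernel_at h k l \<omega> ^ 4) / 2)"
    by (intro integral_mono i2 square_le_half_fourth) (use i in auto)
  also have "\<dots> \<le> 1" using e i by (simp add: prob_space)
  finally show "expectation (\<lambda>\<omega>. (kernel_at h k l \<omega>)\<^sup>2) \<le> 1" .
qed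

text \<open>With (Z k, Z l) held fixed, the first factor is a constant and the second integrates to
  0 over the independent Z m, by degeneracy at the point Z k.\<close>

lemma expectation_kernel_chain:
  assumes h: "degenerate_kernel \<mu> h"
    and klm: "k \<in> {1..n}" "l \<in> {1..n}" "m \<in> {1..n}" "k \<noteq> l" "k \<noteq> m" "l \<noteq> m"
  shows "expectation (\<lambda>\<omega>. kernel_at h k l \<omega> * kernel_at h k m \<omega>) = 0"
\<comment> \<open>A product that is not integrable has Bochner integral 0 by default, so only the
  integrable case calls for Fubini.\<close>
proof (cases "integrable M (\<lambda>\<omega>. kernel_at h k l \<omega> * kernel_at h k m \<omega>)")
  case True
  have [measurable]: "h \<in> borel_measurable (\<mu> \<Otimes>\<^sub>M \<mu>)"
    using h by (simp add: degenerate_kernel_def)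
  let ?A = "\<Pi>\<^sub>M i\<in>{k, l}. \<mu>" and ?B = "\<Pi>\<^sub>M i\<in>{m}. \<mu>"
  let ?U = "\<lambda>\<omega>. \<lambda>i\<in>{k, l}. Z i \<omega>" and ?V = "\<lambda>\<omega>. \<lambda>i\<in>{m}. Z i \<omega>"
  define F where "F = (\<lambda>z. h (fst z k, fst z l) * h (fst z k, snd z m))"
  have [measurable]: "Z k \<in> measurable M \<mu>" "Z l \<in> measurable M \<mu>" "Z m \<in> measurable M \<mu>"
    using klm measurable_Z by auto
  have U [measurable]: "?U \<in> measurable M ?A" and V [measurable]: "?V \<in> measurable M ?B"
    using klm by (auto intro!: measurable_restrict)
  interpret PU: prob_space "distr M ?A ?U" by (rule prob_space_distr) measurable
  interpret PV: prob_space "distr M ?B ?V" by (rule prob_space_distr) measurable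
  interpret P: pair_prob_space "distr M ?A ?U" "distr M ?B ?V" ..
  have F: "F \<in> borel_measurable (?A \<Otimes>\<^sub>M ?B)"
    unfolding F_def by measurable
  have "indep_var ?A ?U ?B ?V"
    by (rule indep_var_restrict[OF indep]) (use klm in auto)
  then have d: "distr M ?A ?U \<Otimes>\<^sub>M distr M ?B ?V = distr M (?A \<Otimes>\<^sub>M ?B) (\<lambda>\<omega>. (?U \<omega>, ?V \<omega>))"
    by (simp add: indep_var_distribution_eq)
  have m: "(\<lambda>\<omega>. (?U \<omega>, ?V \<omega>)) \<in> measurable M (?A \<Otimes>\<^sub>M ?B)"
    by measurable
  have eq: "(\<lambda>\<omega>. kernel_at h k l \<omega> * kernel_at h k m \<omega>) = (\<lambda>\<omega>. F (?U \<omega>, ?V \<omega>))"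
    using klm by (simp add: kernel_at_def F_def)
  have inner: "(\<integral>y. F (x, y) \<partial>distr M ?B ?V) = 0" if x: "x \<in> space ?A" for x
  proof -
    have xk: "x k \<in> space \<mu>" using x by (auto simp: space_PiM PiE_def)
    have [measurable]: "(\<lambda>z. h (x k, z)) \<in> borel_measurable \<mu>" using xk by measurable
    have "(\<integral>y. F (x, y) \<partial>distr M ?B ?V) = expectation (\<lambda>\<omega>. h (x k, x l) * h (x k, Z m \<omega>))"
      by (subst integral_distr) (auto simp: F_def)
    also have "\<dots> = h (x k, x l) * (\<integral>z. h (x k, z) \<partial>distr M \<mu> (Z m))"
      by (subst integral_distr) auto
    also have "\<dots> = 0"
      using degenerate_kernelD(4)[OF h xk] unfolding distr_Z[OF klm(3)] by simp
    finally show ?thesis .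
  qed
  have "integrable (distr M ?A ?U \<Otimes>\<^sub>M distr M ?B ?V) F"
    using True integrable_distr_eq[OF m F] unfolding eq d by simp
  then have "(\<integral>z. F z \<partial>(distr M ?A ?U \<Otimes>\<^sub>M distr M ?B ?V))
      = (\<integral>x. (\<integral>y. F (x, y) \<partial>distr M ?B ?V) \<partial>distr M ?A ?U)"
    by (rule P.integral_fst'[symmetric])
  also have "\<dots> = (\<integral>x. 0 \<partial>distr M ?A ?U)"
    by (rule Bochner_Integration.integral_cong) (use inner in auto)
  finally show ?thesis
    using integral_distr[OF m F] unfolding eq d by simp
qed (simp add: not_integrable_integral_eq)

definition row_sum :: "('b \<times> 'b \<Rightarrow> real) \<Rightarrow> nat \<Rightarrow> 'a \<Rightarrow> real" where
  "row_sum h k \<omega> = (\<Sum>l=1..n. kernel_at h k l \<omega>)"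

text \<open>Distinct entries of a row are orthogonal, so the expanded square keeps only its n
  diagonal terms, each of expectation at most 1.\<close>

lemma
  assumes h: "degenerate_kernel \<mu> h" "(\<integral>z. h z ^ 4 \<partial>(\<mu> \<Otimes>\<^sub>M \<mu>)) \<le> 1" and k: "k \<in> {1..n}"
  shows measurable_row_sum: "row_sum h k \<in> borel_measurable M"
    and integrable_row_sum2: "integrable M (\<lambda>\<omega>. (row_sum h k \<omega>)\<^sup>2)"
    and expectation_row_sum2: "expectation (\<lambda>\<omega>. (row_sum h k \<omega>)\<^sup>2) \<le> real n"
proof -
  show "row_sum h k \<in> borel_measurable M"
    unfolding row_sum_def[abs_def] using measurable_kernel_at[OF h(1) k] by simp
  have eq: "(row_sum h k \<omega>)\<^sup>2 = (\<Sum>l=1..n. \<Sum>m=1..n. kernel_at h k l \<omega> * kernel_at h k m \<omega>)" for \<omega>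
    unfolding row_sum_def power2_eq_square by (rule sum_product)
  have int: "integrable M (\<lambda>\<omega>. kernel_at h k l \<omega> * kernel_at h k m \<omega>)" if "l \<in> {1..n}" "m \<in> {1..n}" for l m
    using that k h by (intro integrable_mult_of_squares integrable_kernel_at2 measurable_kernel_at)
  show "integrable M (\<lambda>\<omega>. (row_sum h k \<omega>)\<^sup>2)"
    unfolding eq by (intro Bochner_Integration.integrable_sum int)
  have "expectation (\<lambda>\<omega>. kernel_at h k l \<omega> * kernel_at h k m \<omega>) \<le> (if l = m then 1 else 0)"
    if "l \<in> {1..n}" "m \<in> {1..n}" for l m
  proof (cases "l = m")
    case True
    then show ?thesis using expectation_kernel_at2[OF h k that(1)] by (simp add: power2_eq_square)
  next
    case False
    then show ?thesis
      using expectation_kernel_chain[OF h(1) k that] by (cases "k = l \<or> k = m") (auto simp: kernel_at_def)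
  qed
  then have "(\<Sum>l=1..n. \<Sum>m=1..n. expectation (\<lambda>\<omega>. kernel_at h k l \<omega> * kernel_at h k m \<omega>))
    \<le> (\<Sum>l=1..n. \<Sum>m=1..n. if l = m then 1 else 0)"
    by (intro sum_mono)
  also have "\<dots> = real n" by simp
  finally show "expectation (\<lambda>\<omega>. (row_sum h k \<omega>)\<^sup>2) \<le> real n"
    unfolding eq by (subst integral_double_sum) (use int in auto)
qed

text \<open>The expanded square runs over two index pairs (k, l) and (k', l'). Disjoint pairs
  contribute 0 and all others at most 1; the four possible coincidences between the pairs leave n^3
  choices each, whence 4 n^3.\<close>

lemma
  assumes h: "degenerate_kernel \<mu> h" "(\<integral>z. h z ^ 4 \<partial>(\<mu> \<Otimes>\<^sub>M \<mu>)) \<le> 1"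
    and e: "degenerate_kernel \<mu> e" "(\<integral>z. e z ^ 4 \<partial>(\<mu> \<Otimes>\<^sub>M \<mu>)) \<le> 1"
  defines "v \<equiv> (\<integral>z. h z * e z \<partial>(\<mu> \<Otimes>\<^sub>M \<mu>))"
  defines "u \<equiv> \<lambda>k l \<omega>. kernel_at h k l \<omega> * kernel_at e k l \<omega> - (if k = l then 0 else v)"
  assumes n: "n \<ge> 2"
  shows kernel_covariance_le_1: "\<bar>v\<bar> \<le> 1"
    and integrable_centered_products2: "integrable M (\<lambda>\<omega>. (\<Sum>k=1..n. \<Sum>l=1..n. u k l \<omega>)\<^sup>2)"
    and expectation_centered_products2:
      "expectation (\<lambda>\<omega>. (\<Sum>k=1..n. \<Sum>l=1..n. u k l \<omega>)\<^sup>2) \<le> 4 * real n ^ 3"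
proof -
  let ?I = "{1..n}"
  let ?w = "\<lambda>k l \<omega>. kernel_at h k l \<omega> * kernel_at e k l \<omega>"
  note meas = measurable_kernel_at[OF h(1)] measurable_kernel_at[OF e(1)]
  have [measurable]: "h \<in> borel_measurable (\<mu> \<Otimes>\<^sub>M \<mu>)" "e \<in> borel_measurable (\<mu> \<Otimes>\<^sub>M \<mu>)"
    using degenerate_kernelD(2) h e by auto
  have h2: "integrable (\<mu> \<Otimes>\<^sub>M \<mu>) (\<lambda>z. (h z)\<^sup>2)" and e2: "integrable (\<mu> \<Otimes>\<^sub>M \<mu>) (\<lambda>z. (e z)\<^sup>2)"
    using mu2.integrable_square_of_fourth degenerate_kernelD(1,2) h(1) e(1) by blast+
  have w: "integrable M (?w k l)" if "k \<in> ?I" "l \<in> ?I" for k l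
    using that h e by (intro integrable_mult_of_squares integrable_kernel_at2 meas)
  have ew: "expectation (?w k l) = v" if "k \<in> ?I" "l \<in> ?I" "k \<noteq> l" for k l
    using expectation_pair[OF that, of "\<lambda>z. h z * e z"] that(3) by (simp add: kernel_at_def v_def)
  have sq: "(x * y)\<^sup>2 = x\<^sup>2 * y\<^sup>2" for x y :: real by (rule power_mult_distrib)
  have w2: "integrable M (\<lambda>\<omega>. (?w k l \<omega>)\<^sup>2)"
    and ew2: "expectation (\<lambda>\<omega>. (?w k l \<omega>)\<^sup>2) \<le> 1" if "k \<in> ?I" "l \<in> ?I" for k l
  proof -
    note [measurable] = meas[OF that]
    have h4: "integrable M (\<lambda>\<omega>. ((kernel_at h k l \<omega>)\<^sup>2)\<^sup>2)" "expectation (\<lambda>\<omega>. ((kernel_at h k l \<omega>)\<^sup>2)\<^sup>2) \<le> 1"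
      using integrable_kernel_at4[OF h that] expectation_kernel_at4[OF h that] by simp_all
    have e4: "integrable M (\<lambda>\<omega>. ((kernel_at e k l \<omega>)\<^sup>2)\<^sup>2)" "expectation (\<lambda>\<omega>. ((kernel_at e k l \<omega>)\<^sup>2)\<^sup>2) \<le> 1"
      using integrable_kernel_at4[OF e that] expectation_kernel_at4[OF e that] by simp_all
    show "integrable M (\<lambda>\<omega>. (?w k l \<omega>)\<^sup>2)"
      unfolding sq by (intro integrable_mult_of_squares h4 e4) measurable
    have "expectation (\<lambda>\<omega>. (?w k l \<omega>)\<^sup>2)
        = expectation (\<lambda>\<omega>. \<bar>(kernel_at h k l \<omega>)\<^sup>2 * (kernel_at e k l \<omega>)\<^sup>2\<bar>)"
      by (simp add: sq)
    also have "\<dots> \<le> (1 + 1) / 2"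
      by (rule order_trans[OF integral_abs_mult_le[OF h4(1) e4(1)]]) (use h4 e4 in auto)
    finally show "expectation (\<lambda>\<omega>. (?w k l \<omega>)\<^sup>2) \<le> 1" by simp
  qed
  have 12: "1 \<in> ?I" "2 \<in> ?I" "(1::nat) \<noteq> 2" using n by auto
  have "\<bar>v\<bar> \<le> expectation (\<lambda>\<omega>. \<bar>?w 1 2 \<omega>\<bar>)"
    unfolding ew[OF 12, symmetric] by (rule integral_abs_bound)
  also have "\<dots> \<le> (1 + 1) / 2"
    by (rule order_trans[OF integral_abs_mult_le])
       (use integrable_kernel_at2[OF h 12(1,2)] expectation_kernel_at2[OF h 12(1,2)] meas[OF 12(1,2)]
          integrable_kernel_at2[OF e 12(1,2)] expectation_kernel_at2[OF e 12(1,2)] in simp_all)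
  finally show v: "\<bar>v\<bar> \<le> 1" by simp
  have u2: "integrable M (\<lambda>\<omega>. (u k l \<omega>)\<^sup>2)" "expectation (\<lambda>\<omega>. (u k l \<omega>)\<^sup>2) \<le> 1"
    and um: "u k l \<in> borel_measurable M" and u1: "integrable M (u k l)" "expectation (u k l) = 0"
    if kl: "k \<in> ?I" "l \<in> ?I" for k l
  proof -
    have eq: "(\<lambda>\<omega>. (u k l \<omega>)\<^sup>2) = (\<lambda>\<omega>. (?w k l \<omega>)\<^sup>2 - 2 * v * ?w k l \<omega> + v\<^sup>2)" if "k \<noteq> l"
      using that by (auto simp: u_def power2_diff fun_eq_iff)
    show "integrable M (\<lambda>\<omega>. (u k l \<omega>)\<^sup>2)"
    proof (cases "k = l")
      case False
      show ?thesis unfolding eq[OF False] using w2[OF kl] w[OF kl] by simp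
    qed (simp add: u_def kernel_at_def)
    show "expectation (\<lambda>\<omega>. (u k l \<omega>)\<^sup>2) \<le> 1"
    proof (cases "k = l")
      case False
      have "expectation (\<lambda>\<omega>. (u k l \<omega>)\<^sup>2) = expectation (\<lambda>\<omega>. (?w k l \<omega>)\<^sup>2) - v\<^sup>2"
        unfolding eq[OF False] using w2[OF kl] w[OF kl] ew[OF kl False]
        by (simp add: prob_space power2_eq_square)
      also have "\<dots> \<le> 1 - 0" using ew2[OF kl] by (intro diff_mono) auto
      finally show ?thesis by simp
    qed (simp add: u_def kernel_at_def)
    show "u k l \<in> borel_measurable M" unfolding u_def using meas[OF kl] by measurable
    show "integrable M (u k l)" unfolding u_def using w[OF kl] by simp
    show "expectation (u k l) = 0"
    proof (cases "k = l")
      case False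
      show ?thesis unfolding u_def using w[OF kl] ew[OF kl False] False by (simp add: prob_space)
    qed (simp add: u_def kernel_at_def)
  qed
  \<comment> \<open>The right-hand side counts coincidences: it is 0 exactly for disjoint pairs and
    at least 1 otherwise, and each indicator sums to n^3 over the four indices.\<close>
  have cov: "expectation (\<lambda>\<omega>. u k l \<omega> * u k' l' \<omega>)
      \<le> of_bool (k = k') + of_bool (k = l') + of_bool (l = k') + of_bool (l = l')"
    if kl: "k \<in> ?I" "l \<in> ?I" and kl': "k' \<in> ?I" "l' \<in> ?I" for k l k' l'
  proof (cases "{k, l} \<inter> {k', l'} = {}")
    case True
    have "expectation (\<lambda>\<omega>. u k l \<omega> * u k' l' \<omega>) = expectation (u k l) * expectation (u k' l')"
    proof (rule indep_var_lebesgue_integral[OF _ u1(1)[OF kl] u1(1)[OF kl']])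
      \<comment> \<open>The indices enter \<open>f\<close> only through i = j, where the centred
        product is constantly 0; this lets diagonal pairs (Z k, Z k) go through the same
        independence argument.\<close>
      define f where "f = (\<lambda>i j z. if i = (j::nat) then 0 else h z * e z - v)"
      have [measurable]: "f i j \<in> borel_measurable (\<mu> \<Otimes>\<^sub>M \<mu>)" for i j
        unfolding f_def by measurable
      have eq: "u i j = f i j \<circ> (\<lambda>\<omega>. (Z i \<omega>, Z j \<omega>))" for i j
        by (auto simp: u_def f_def kernel_at_def fun_eq_iff)
      show "indep_var borel (u k l) borel (u k' l')"
        unfolding eq by (rule indep_var_compose[OF indep_var_pair_pair]) (use that True in auto)
    qed
    then show ?thesis using u1(2) kl kl' by simp
  next
    case False
    have "expectation (\<lambda>\<omega>. u k l \<omega> * u k' l' \<omega>) \<le> expectation (\<lambda>\<omega>. \<bar>u k l \<omega> * u k' l' \<omega>\<bar>)"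
      using integral_abs_bound[of M "\<lambda>\<omega>. u k l \<omega> * u k' l' \<omega>"] by linarith
    also have "\<dots> \<le> (1 + 1) / 2"
      by (rule order_trans[OF integral_abs_mult_le])
         (use u2[OF kl] u2[OF kl'] um[OF kl] um[OF kl'] in simp_all)
    also have "\<dots> \<le> of_bool (k = k') + of_bool (k = l') + of_bool (l = k') + of_bool (l = l')"
      using False by auto
    finally show ?thesis .
  qed
  have uu: "integrable M (\<lambda>\<omega>. u k l \<omega> * u k' l' \<omega>)" if "k \<in> ?I" "l \<in> ?I" "k' \<in> ?I" "l' \<in> ?I" for k l k' l'
    using that by (intro integrable_mult_of_squares u2 um)
  have eq: "(\<Sum>k\<in>?I. \<Sum>l\<in>?I. u k l \<omega>)\<^sup>2
      = (\<Sum>k\<in>?I. \<Sum>k'\<in>?I. \<Sum>l\<in>?I. \<Sum>l'\<in>?I. u k l \<omega> * u k' l' \<omega>)" for \<omega>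
    unfolding power2_eq_square sum_product ..
  have inner: "integrable M (\<lambda>\<omega>. \<Sum>l\<in>?I. \<Sum>l'\<in>?I. u k l \<omega> * u k' l' \<omega>)"
    if "k \<in> ?I" "k' \<in> ?I" for k k'
    using that by (intro Bochner_Integration.integrable_sum uu)
  show "integrable M (\<lambda>\<omega>. (\<Sum>k\<in>?I. \<Sum>l\<in>?I. u k l \<omega>)\<^sup>2)"
    unfolding eq by (intro Bochner_Integration.integrable_sum inner)
  have "expectation (\<lambda>\<omega>. (\<Sum>k\<in>?I. \<Sum>l\<in>?I. u k l \<omega>)\<^sup>2)
      = (\<Sum>k\<in>?I. \<Sum>k'\<in>?I. expectation (\<lambda>\<omega>. \<Sum>l\<in>?I. \<Sum>l'\<in>?I. u k l \<omega> * u k' l' \<omega>))"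
    unfolding eq by (rule integral_double_sum[OF inner])
  also have "\<dots> = (\<Sum>k\<in>?I. \<Sum>k'\<in>?I. \<Sum>l\<in>?I. \<Sum>l'\<in>?I. expectation (\<lambda>\<omega>. u k l \<omega> * u k' l' \<omega>))"
    by (intro sum.cong refl integral_double_sum uu)
  also have "\<dots> \<le> (\<Sum>k\<in>?I. \<Sum>k'\<in>?I. \<Sum>l\<in>?I. \<Sum>l'\<in>?I.
      of_bool (k = k') + of_bool (k = l') + of_bool (l = k') + of_bool (l = l'))"
    by (intro sum_mono cov)
  also have "\<dots> = 4 * real n ^ 3"
    by (simp add: sum.distrib of_bool_def sum.delta sum.delta' sum_distrib_left[symmetric] power3_eq_cube)
  finally show "expectation (\<lambda>\<omega>. (\<Sum>k\<in>?I. \<Sum>l\<in>?I. u k l \<omega>)\<^sup>2) \<le> 4 * real n ^ 3" .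
qed

section \<open>Mean deviation of the sample covariance\<close>

lemma
  assumes h: "degenerate_kernel \<mu> h" "(\<integral>z. h z ^ 4 \<partial>(\<mu> \<Otimes>\<^sub>M \<mu>)) \<le> 1"
    and e: "degenerate_kernel \<mu> e" "(\<integral>z. e z ^ 4 \<partial>(\<mu> \<Otimes>\<^sub>M \<mu>)) \<le> 1"
    and n: "n \<ge> 4"
  defines "v \<equiv> (\<integral>z. h z * e z \<partial>(\<mu> \<Otimes>\<^sub>M \<mu>))"
  defines "V \<equiv> \<lambda>\<omega>. sample_dcov n (\<lambda>k l. kernel_at h k l \<omega>) (\<lambda>k l. kernel_at e k l \<omega>)"
  shows integrable_sample_dcov_normalized: "integrable M V"
    and expectation_sample_dcov_normalized: "expectation (\<lambda>\<omega>. \<bar>V \<omega> - v\<bar>) \<le> 28 / sqrt (real n)"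
proof -
  let ?I = "{1..n}"
  define u where "u = (\<lambda>k l \<omega>. kernel_at h k l \<omega> * kernel_at e k l \<omega> - (if k = l then 0 else v))"
  define U where "U = (\<lambda>\<omega>. \<Sum>k\<in>?I. \<Sum>l\<in>?I. u k l \<omega>)"
  define m where "m = (real n - 1) * (real n - 2)"
  define N where "N = real n * (real n - 3)"
  \<comment> \<open>The square root of the bound 4 n^3 on the second moment of \<open>U\<close>.
    With this weight |U| \<le> (U^2/c + c)/2 gives E|U| \<le> c, as Cauchy-Schwarz would.\<close>
  define c where "c = 2 * real n * sqrt (real n)"
  have n2: "n \<ge> 2" using n by simp
  have c: "c > 0" using n by (simp add: c_def)
  have m: "m > 0" using n by (simp add: m_def)
  have N: "N > 0" using n by (simp add: N_def)
  have v1: "\<bar>v\<bar> \<le> 1" unfolding v_def by (rule kernel_covariance_le_1[OF h e n2])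
  have U2: "integrable M (\<lambda>\<omega>. (U \<omega>)\<^sup>2)" and EU2: "expectation (\<lambda>\<omega>. (U \<omega>)\<^sup>2) \<le> 4 * real n ^ 3"
    unfolding U_def u_def v_def
    by (rule integrable_centered_products2[OF h e n2] expectation_centered_products2[OF h e n2])+
  note r = integrable_row_sum2[OF h] expectation_row_sum2[OF h] measurable_row_sum[OF h]
  note t = integrable_row_sum2[OF e] expectation_row_sum2[OF e] measurable_row_sum[OF e]
  note meas = measurable_kernel_at[OF h(1)] measurable_kernel_at[OF e(1)]
  \<comment> \<open>There are n(n-1) = \<open>N\<close> + 2n off-diagonal entries, but the statistic
    is divided by \<open>N\<close>. The excess 2 n v is not cancelled against the row-sum terms; it
    is bounded by 2n, which is of lower order.\<close>
  have sum_u: "(\<Sum>k\<in>?I. \<Sum>l\<in>?I. kernel_at h k l \<omega> * kernel_at e k l \<omega>) = U \<omega> + (N + 2 * real n) * v" for \<omega>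
  proof -
    have "U \<omega> = (\<Sum>k\<in>?I. \<Sum>l\<in>?I. kernel_at h k l \<omega> * kernel_at e k l \<omega> - (v - (if k = l then v else 0)))"
      unfolding U_def u_def by (intro sum.cong refl) simp
    also have "\<dots> = (\<Sum>k\<in>?I. \<Sum>l\<in>?I. kernel_at h k l \<omega> * kernel_at e k l \<omega>) - real n * (real n - 1) * v"
      by (simp add: sum_subtractf sum.distrib) (simp add: algebra_simps)
    finally show ?thesis by (simp add: N_def algebra_simps)
  qed
  have V: "V \<omega> = (U \<omega> + (N + 2 * real n) * v
      - 2 / (real n - 2) * (\<Sum>k\<in>?I. row_sum h k \<omega> * row_sum e k \<omega>)
      + (\<Sum>k\<in>?I. row_sum h k \<omega>) * (\<Sum>k\<in>?I. row_sum e k \<omega>) / m) / N" for \<omega>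
    unfolding V_def row_sum_def m_def N_def sum_u[unfolded N_def, symmetric]
    by (rule sample_dcov_expand[OF n])
       (use degenerate_kernelD(3) h(1) e(1) in \<open>auto simp: kernel_at_def\<close>)
  define Q where "Q = (\<lambda>\<omega>. \<Sum>k\<in>?I. (row_sum h k \<omega>)\<^sup>2 + (row_sum e k \<omega>)\<^sup>2)"
  have Q: "integrable M Q"
    unfolding Q_def using r(1) t(1) by (intro Bochner_Integration.integrable_sum Bochner_Integration.integrable_add)
  have "expectation Q = (\<Sum>k\<in>?I. expectation (\<lambda>\<omega>. (row_sum h k \<omega>)\<^sup>2) + expectation (\<lambda>\<omega>. (row_sum e k \<omega>)\<^sup>2))"
    unfolding Q_def using r(1) t(1) by (subst Bochner_Integration.integral_sum) auto
  also have "\<dots> \<le> (\<Sum>k\<in>?I. real n + real n)"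
    using r(2) t(2) by (intro sum_mono add_mono)
  finally have EQ: "expectation Q \<le> 2 * (real n)\<^sup>2" by (simp add: power2_eq_square)
  \<comment> \<open>A majorant that is affine in U^2 and \<open>Q\<close>, so that its mean follows
    from second moments alone.\<close>
  define W where "W = (\<lambda>\<omega>. ((U \<omega>)\<^sup>2 / c + c) / 2 + 2 * real n + Q \<omega> / (real n - 2) + real n * Q \<omega> / (2 * m))"
  have W: "integrable M W"
    unfolding W_def using U2 Q by auto
  have bound: "\<bar>V \<omega> - v\<bar> \<le> W \<omega> / N" for \<omega>
  proof -
    let ?r = "\<lambda>k. row_sum h k \<omega>" and ?t = "\<lambda>k. row_sum e k \<omega>"
    have 1: "\<bar>U \<omega>\<bar> \<le> ((U \<omega>)\<^sup>2 / c + c) / 2"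
      using abs_mult_le_half_squares[of "U \<omega> / sqrt c" "sqrt c"] c
      by (simp add: power_divide)
    have 2: "\<bar>\<Sum>k\<in>?I. ?r k * ?t k\<bar> \<le> Q \<omega> / 2"
    proof -
      have "\<bar>\<Sum>k\<in>?I. ?r k * ?t k\<bar> \<le> (\<Sum>k\<in>?I. \<bar>?r k * ?t k\<bar>)" by (rule sum_abs)
      also have "\<dots> \<le> (\<Sum>k\<in>?I. ((?r k)\<^sup>2 + (?t k)\<^sup>2) / 2)"
        by (intro sum_mono abs_mult_le_half_squares)
      finally show ?thesis by (simp add: Q_def sum_divide_distrib)
    qed
    have 3: "\<bar>(\<Sum>k\<in>?I. ?r k) * (\<Sum>k\<in>?I. ?t k)\<bar> \<le> real n * Q \<omega> / 2"
    proof -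
      \<comment> \<open>Cauchy-Schwarz loses a factor n here; the denominator \<open>m\<close>, of
        order n^2, absorbs it.\<close>
      have sq: "(\<Sum>k\<in>?I. f k)\<^sup>2 \<le> real n * (\<Sum>k\<in>?I. (f k)\<^sup>2)" for f :: "nat \<Rightarrow> real"
        using Cauchy_Schwarz_ineq_sum[of "\<lambda>_. 1" f ?I] by simp
      have "\<bar>(\<Sum>k\<in>?I. ?r k) * (\<Sum>k\<in>?I. ?t k)\<bar> \<le> ((\<Sum>k\<in>?I. ?r k)\<^sup>2 + (\<Sum>k\<in>?I. ?t k)\<^sup>2) / 2"
        by (rule abs_mult_le_half_squares)
      also have "\<dots> \<le> (real n * (\<Sum>k\<in>?I. (?r k)\<^sup>2) + real n * (\<Sum>k\<in>?I. (?t k)\<^sup>2)) / 2"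
        by (intro divide_right_mono add_mono sq) simp
      finally show ?thesis by (simp add: Q_def sum.distrib algebra_simps)
    qed
    have Vv: "V \<omega> - v = (U \<omega> + 2 * real n * v - 2 / (real n - 2) * (\<Sum>k\<in>?I. ?r k * ?t k)
        + (\<Sum>k\<in>?I. ?r k) * (\<Sum>k\<in>?I. ?t k) / m) / N"
      unfolding V using N by (simp add: diff_divide_distrib add_divide_distrib distrib_right)
    have "\<bar>V \<omega> - v\<bar> = \<bar>U \<omega> + 2 * real n * v - 2 / (real n - 2) * (\<Sum>k\<in>?I. ?r k * ?t k)
        + (\<Sum>k\<in>?I. ?r k) * (\<Sum>k\<in>?I. ?t k) / m\<bar> / N"
      unfolding Vv by (simp only: abs_divide abs_of_pos[OF N])
    also have "\<dots> \<le> (\<bar>U \<omega>\<bar> + 2 * real n * \<bar>v\<bar> + 2 / (real n - 2) * \<bar>\<Sum>k\<in>?I. ?r k * ?t k\<bar>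
        + \<bar>(\<Sum>k\<in>?I. ?r k) * (\<Sum>k\<in>?I. ?t k)\<bar> / m) / N"
    proof -
      have *: "\<bar>x + 2 * real n * v - 2 / (real n - 2) * z + w / m\<bar>
          \<le> \<bar>x\<bar> + 2 * real n * \<bar>v\<bar> + 2 / (real n - 2) * \<bar>z\<bar> + \<bar>w\<bar> / m" for x z w
      proof -
        have "\<bar>2 * real n * v\<bar> = 2 * real n * \<bar>v\<bar>" "\<bar>2 / (real n - 2) * z\<bar> = 2 / (real n - 2) * \<bar>z\<bar>"
          "\<bar>w / m\<bar> = \<bar>w\<bar> / m"
          using n m by (simp_all add: abs_mult)
        then show ?thesis by linarith
      qed
      show ?thesis
        by (rule divide_right_mono[OF *]) (use N in simp)
    qed
    also have "\<dots> \<le> (((U \<omega>)\<^sup>2 / c + c) / 2 + 2 * real n * 1 + 2 / (real n - 2) * (Q \<omega> / 2)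
        + (real n * Q \<omega> / 2) / m) / N"
    proof -
      have A: "\<bar>(\<Sum>k\<in>?I. ?r k) * (\<Sum>k\<in>?I. ?t k)\<bar> / m \<le> (real n * Q \<omega> / 2) / m"
        by (rule divide_right_mono[OF 3]) (use m in simp)
      have B: "2 / (real n - 2) * \<bar>\<Sum>k\<in>?I. ?r k * ?t k\<bar> \<le> 2 / (real n - 2) * (Q \<omega> / 2)"
        by (rule mult_left_mono[OF 2]) (use n in simp)
      have C: "2 * real n * \<bar>v\<bar> \<le> 2 * real n * 1"
        by (rule mult_left_mono[OF v1]) simp
      show ?thesis
        by (rule divide_right_mono[OF add_mono[OF add_mono[OF add_mono[OF 1 C] B] A]]) (use N in simp)
    qed
    finally show ?thesis by (simp add: W_def mult.commute)
  qed
  have mV: "V \<in> borel_measurable M"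
  proof -
    have [measurable]: "U \<in> borel_measurable M"
      unfolding U_def u_def using meas by (intro borel_measurable_sum borel_measurable_diff borel_measurable_times) auto
    show ?thesis
      unfolding V[abs_def] using r(3) t(3)
      by (intro borel_measurable_divide borel_measurable_add borel_measurable_diff borel_measurable_times
          borel_measurable_sum) auto
  qed
  have d: "integrable M (\<lambda>\<omega>. V \<omega> - v)"
    by (rule Bochner_Integration.integrable_bound[of M "\<lambda>\<omega>. W \<omega> / N"])
       (use W mV bound order_trans[OF bound abs_ge_self] in auto)
  from Bochner_Integration.integrable_add[OF d, of "\<lambda>_. v"] show "integrable M V" by simp
  have "expectation (\<lambda>\<omega>. \<bar>V \<omega> - v\<bar>) \<le> expectation (\<lambda>\<omega>. W \<omega> / N)"
    by (intro integral_mono integrable_abs d bound) (use W in auto)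
  also have "\<dots> = ((expectation (\<lambda>\<omega>. (U \<omega>)\<^sup>2) / c + c) / 2 + 2 * real n + expectation Q / (real n - 2)
      + real n * expectation Q / (2 * m)) / N"
    unfolding W_def using U2 Q by (simp add: prob_space)
  also have "\<dots> \<le> ((4 * real n ^ 3 / c + c) / 2 + 2 * real n + 2 * (real n)\<^sup>2 / (real n - 2)
      + real n * (2 * (real n)\<^sup>2) / (2 * m)) / N"
    using N m n c EU2 EQ by (intro divide_right_mono add_mono mult_left_mono) auto
  \<comment> \<open>With x = sqrt n \<ge> 2 the main term is 2 n x, and the lower-order terms 2n,
    4n, 4n are together at most 5 n x. As n \<ge> 4 gives n(n-3) \<ge> n^2/4, the total 7 n x
    becomes 28/x.\<close>
  also have "\<dots> \<le> 28 / sqrt (real n)"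
  proof -
    define x where "x = sqrt (real n)"
    have x: "x \<ge> 2" "real n = x * x" using n real_le_rsqrt[of 2 "real n"] by (auto simp: x_def)
    have cx: "c = 2 * (real n * x)" by (simp add: c_def x_def)
    have A: "(4 * real n ^ 3 / c + c) / 2 = 2 * (real n * x)"
      unfolding cx x(2) using x(1) by (simp add: field_simps power3_eq_cube)
    have B: "2 * (real n)\<^sup>2 / (real n - 2) \<le> 4 * real n"
      using n by (simp add: divide_le_eq power2_eq_square)
    have "4 * m - (real n)\<^sup>2 = 3 * real n * (real n - 4) + 8"
      by (simp add: m_def power2_eq_square algebra_simps)
    moreover have "0 \<le> 3 * real n * (real n - 4)" using n by simp
    ultimately have "(real n)\<^sup>2 \<le> 4 * m" by linarith
    then have C: "real n * (2 * (real n)\<^sup>2) / (2 * m) \<le> 4 * real n"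
      using m mult_left_mono[of "(real n)\<^sup>2" "4 * m" "real n"] by (simp add: divide_le_eq)
    have D: "10 * real n \<le> 5 * (real n * x)" using x(1) n by simp
    have E: "7 * (real n * x) / N \<le> 28 / x"
    proof -
      have "7 * (real n * x) * x \<le> 28 * N"
        using n unfolding N_def by (simp add: mult.assoc flip: x(2))
      then show ?thesis using N x(1) by (simp add: field_simps)
    qed
    have "((4 * real n ^ 3 / c + c) / 2 + 2 * real n + 2 * (real n)\<^sup>2 / (real n - 2)
      + real n * (2 * (real n)\<^sup>2) / (2 * m)) / N \<le> 7 * (real n * x) / N"
      using A B C D N by (intro divide_right_mono) linarith+
    also note E
    finally show ?thesis by (simp add: x_def)
  qed
  finally show "expectation (\<lambda>\<omega>. \<bar>V \<omega> - v\<bar>) \<le> 28 / sqrt (real n)" .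
qed

text \<open>\<open>a\<close> and \<open>b\<close> are the fourth-moment norms of the kernels. The
  sample and the population covariance are both bilinear, so dividing the kernels by these norms
  reduces the claim to the normalised case, where Markov's inequality is applied to the mean
  absolute error.\<close>

lemma
  assumes h: "degenerate_kernel \<mu> h" "(\<integral>z. h z ^ 4 \<partial>(\<mu> \<Otimes>\<^sub>M \<mu>)) = a ^ 4" "a > 0"
    and e: "degenerate_kernel \<mu> e" "(\<integral>z. e z ^ 4 \<partial>(\<mu> \<Otimes>\<^sub>M \<mu>)) = b ^ 4" "b > 0"
    and n: "n \<ge> 4"
  defines "v \<equiv> (\<integral>z. h z * e z \<partial>(\<mu> \<Otimes>\<^sub>M \<mu>))"
  defines "V \<equiv> \<lambda>\<omega>. sample_dcov n (\<lambda>k l. kernel_at h k l \<omega>) (\<lambda>k l. kernel_at e k l \<omega>)"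
  shows integrable_sample_dcov: "integrable M V"
    and prob_sample_dcov_deviation:
      "\<delta> > 0 \<Longrightarrow> prob {\<omega>\<in>space M. \<delta> \<le> \<bar>V \<omega> - v\<bar>} \<le> 28 * (a * b) / (sqrt (real n) * \<delta>)"
proof -
  have scale: "degenerate_kernel \<mu> (\<lambda>z. f z / c)" "(\<integral>z. (f z / c) ^ 4 \<partial>(\<mu> \<Otimes>\<^sub>M \<mu>)) \<le> 1"
    if f: "degenerate_kernel \<mu> f" "(\<integral>z. f z ^ 4 \<partial>(\<mu> \<Otimes>\<^sub>M \<mu>)) = c ^ 4" "c > 0" for f :: "'b \<times> 'b \<Rightarrow> real" and c
    using f by (auto simp: degenerate_kernel_def power_divide)
  note h' = scale[OF h] and e' = scale[OF e]
  have kernel_scale: "kernel_at f k l \<omega> = c * kernel_at (\<lambda>z. f z / c) k l \<omega>" if "c > 0" for f c k l \<omega>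
    using that by (simp add: kernel_at_def)
  define V' where "V' = (\<lambda>\<omega>. sample_dcov n (\<lambda>k l. kernel_at (\<lambda>z. h z / a) k l \<omega>) (\<lambda>k l. kernel_at (\<lambda>z. e z / b) k l \<omega>))"
  define v' where "v' = (\<integral>z. h z / a * (e z / b) \<partial>(\<mu> \<Otimes>\<^sub>M \<mu>))"
  have V: "V \<omega> = a * b * V' \<omega>" for \<omega>
    unfolding V_def V'_def kernel_scale[OF h(3), of h] kernel_scale[OF e(3), of e]
    by (rule sample_dcov_scale)
  have v: "v = a * b * v'"
    unfolding v_def v'_def using h(3) e(3) by simp
  have V'i: "integrable M V'" and EV': "expectation (\<lambda>\<omega>. \<bar>V' \<omega> - v'\<bar>) \<le> 28 / sqrt (real n)"
    unfolding V'_def v'_def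
    by (rule integrable_sample_dcov_normalized[OF h' e' n] expectation_sample_dcov_normalized[OF h' e' n])+
  show "integrable M V" unfolding V[abs_def] using V'i by simp
  assume \<delta>: "\<delta> > 0"
  have "{\<omega>\<in>space M. \<delta> \<le> \<bar>V \<omega> - v\<bar>} = {\<omega>\<in>space M. \<delta> / (a * b) \<le> \<bar>V' \<omega> - v'\<bar>}"
  proof -
    have "\<bar>V \<omega> - v\<bar> = a * b * \<bar>V' \<omega> - v'\<bar>" for \<omega>
      unfolding V v using h(3) e(3) by (simp add: abs_mult flip: right_diff_distrib)
    then show ?thesis using h(3) e(3) by (simp add: divide_le_eq mult.commute)
  qed
  then have "prob {\<omega>\<in>space M. \<delta> \<le> \<bar>V \<omega> - v\<bar>} \<le> expectation (\<lambda>\<omega>. \<bar>V' \<omega> - v'\<bar>) / (\<delta> / (a * b))"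
    using V'i \<delta> h(3) e(3) by (simp only:) (intro integral_Markov_inequality_measure[where A = "{}"], auto)
  also have "\<dots> \<le> 28 / sqrt (real n) / (\<delta> / (a * b))"
    using \<delta> h(3) e(3) by (intro divide_right_mono EV') auto
  finally show "prob {\<omega>\<in>space M. \<delta> \<le> \<bar>V \<omega> - v\<bar>} \<le> 28 * (a * b) / (sqrt (real n) * \<delta>)"
    by (simp add: field_simps)
qed

end

section \<open>Conditional expectations and double centring\<close>

lemma fourth_power_add_le: "(x + y) ^ 4 \<le> 8 * (x ^ 4 + y ^ 4)" for x y :: real
proof -
  have sq: "(a + b)\<^sup>2 \<le> 2 * (a\<^sup>2 + b\<^sup>2)" for a b :: real
    using sum_squares_ge_zero[of "a - b" 0] by (simp add: power2_eq_square algebra_simps)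
  have "(x + y) ^ 4 = ((x + y)\<^sup>2)\<^sup>2" by simp
  also have "\<dots> \<le> (2 * (x\<^sup>2 + y\<^sup>2))\<^sup>2"
    by (intro power_mono sq) simp
  also have "\<dots> = 4 * (x\<^sup>2 + y\<^sup>2)\<^sup>2" unfolding power_mult_distrib by simp
  also have "\<dots> \<le> 4 * (2 * ((x\<^sup>2)\<^sup>2 + (y\<^sup>2)\<^sup>2))" by (intro mult_left_mono sq) simp
  finally show ?thesis by simp
qed

lemma (in prob_space) expectation_square_le:
  fixes f :: "'a \<Rightarrow> real"
  assumes f2: "integrable M (\<lambda>x. (f x)\<^sup>2)" and [measurable]: "f \<in> borel_measurable M"
  shows "(expectation f)\<^sup>2 \<le> expectation (\<lambda>x. (f x)\<^sup>2)"
proof -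
  have f: "integrable M f"
    using integrable_mult_of_squares[OF f2, of "\<lambda>_. 1"] by simp
  have "0 \<le> variance f" by simp
  also have "\<dots> = expectation (\<lambda>x. (f x)\<^sup>2) - (expectation f)\<^sup>2"
    by (rule variance_eq[OF f f2])
  finally show ?thesis by simp
qed

lemma (in prob_space) expectation_fourth_le:
  fixes f :: "'a \<Rightarrow> real"
  assumes f4: "integrable M (\<lambda>x. f x ^ 4)" and [measurable]: "f \<in> borel_measurable M"
  shows "(expectation f) ^ 4 \<le> expectation (\<lambda>x. f x ^ 4)"
proof -
  have f2: "integrable M (\<lambda>x. (f x)\<^sup>2)" by (rule integrable_square_of_fourth[OF f4]) measurable
  have "(expectation f) ^ 4 = ((expectation f)\<^sup>2)\<^sup>2" by simp
  also have "\<dots> \<le> (expectation (\<lambda>x. (f x)\<^sup>2))\<^sup>2"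
    by (intro power_mono expectation_square_le f2) auto
  also have "\<dots> \<le> expectation (\<lambda>x. ((f x)\<^sup>2)\<^sup>2)"
    by (rule expectation_square_le) (use f4 in auto)
  finally show ?thesis by simp
qed

lemma (in prob_space) integrable_of_fourth:
  fixes f :: "'a \<Rightarrow> real"
  assumes "integrable M (\<lambda>x. f x ^ 4)" and [measurable]: "f \<in> borel_measurable M"
  shows "integrable M f"
  using integrable_mult_of_squares[OF integrable_square_of_fourth[OF assms], of "\<lambda>_. 1"] by simp

lemma integrable_fourth_bound:
  fixes f b :: "'a \<Rightarrow> real"
  assumes b: "integrable M b" and [measurable]: "f \<in> borel_measurable M"
    and le: "\<And>x. x \<in> space M \<Longrightarrow> f x ^ 4 \<le> b x"
  shows "integrable M (\<lambda>x. f x ^ 4)"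
proof (rule Bochner_Integration.integrable_bound[OF b])
  show "AE x in M. norm (f x ^ 4) \<le> norm (b x)"
  proof (rule AE_I2)
    fix x assume "x \<in> space M"
    from le[OF this] have "f x ^ 4 \<le> \<bar>b x\<bar>" by linarith
    moreover have "norm (f x ^ 4) = f x ^ 4" by simp
    ultimately show "norm (f x ^ 4) \<le> norm (b x)" by simp
  qed
qed measurable

text \<open>The events generated by \<open>U\<close> are preimages of sets S, and on the product law
  the integral over such an event factors by Fubini into an outer integral over S and the inner
  integral on the right. This is the defining property of the conditional expectation.\<close>

lemma (in prob_space) real_cond_exp_indep:
  fixes f :: "'b \<times> 'b \<Rightarrow> real"
  assumes UV: "indep_var N U N V" and f [measurable]: "f \<in> borel_measurable (N \<Otimes>\<^sub>M N)"
    and int: "integrable M (\<lambda>\<omega>. f (U \<omega>, V \<omega>))"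
  shows "AE \<omega> in M. real_cond_exp M (vimage_algebra (space M) U N) (\<lambda>\<omega>. f (U \<omega>, V \<omega>)) \<omega>
      = (\<integral>v. f (U \<omega>, v) \<partial>distr M N V)"
proof -
  have [measurable]: "U \<in> measurable M N" "V \<in> measurable M N"
    using UV by (auto simp: indep_var_distribution_eq)
  let ?F = "vimage_algebra (space M) U N"
  have "subalgebra M ?F"
    unfolding subalgebra_def
    by (auto simp: sets_vimage_algebra2 measurable_space[OF \<open>U \<in> measurable M N\<close>])
  then interpret finite_measure_subalgebra M ?F
    by unfold_locales
  interpret N1: prob_space "distr M N U" by (rule prob_space_distr) measurable
  interpret N2: prob_space "distr M N V" by (rule prob_space_distr) measurable
  interpret P: pair_prob_space "distr M N U" "distr M N V" ..
  have d: "distr M (N \<Otimes>\<^sub>M N) (\<lambda>\<omega>. (U \<omega>, V \<omega>)) = distr M N U \<Otimes>\<^sub>M distr M N V"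
    using UV by (simp add: indep_var_distribution_eq)
  define g where "g = (\<lambda>u. \<integral>v. f (u, v) \<partial>distr M N V)"
  have g [measurable]: "g \<in> borel_measurable N"
    unfolding g_def by measurable
  have intf: "integrable (distr M N U \<Otimes>\<^sub>M distr M N V) f"
    unfolding d[symmetric] by (subst integrable_distr_eq) (use int in auto)
  have intg: "integrable M (\<lambda>\<omega>. g (U \<omega>))"
    using P.integrable_fst'[OF intf] unfolding g_def[symmetric] by (simp add: integrable_distr_eq)
  have "AE \<omega> in M. real_cond_exp M ?F (\<lambda>\<omega>. f (U \<omega>, V \<omega>)) \<omega> = g (U \<omega>)"
  proof (rule real_cond_exp_charact[OF _ int intg])
    have "U \<in> measurable ?F N" by (rule measurable_vimage_algebra1) (auto intro: measurable_space)
    then show "(\<lambda>\<omega>. g (U \<omega>)) \<in> borel_measurable ?F" using g by (rule measurable_compose)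
    fix A assume "A \<in> sets ?F"
    then obtain S where S [measurable]: "S \<in> sets N" and A: "A = U -` S \<inter> space M"
      by (subst (asm) sets_vimage_algebra2) (auto intro: measurable_space)
    have iA: "indicator A \<omega> = indicator S (U \<omega>)" if "\<omega> \<in> space M" for \<omega>
      using that by (simp add: A indicator_def)
    let ?k = "\<lambda>z. indicator S (fst z) * f z"
    have k [measurable]: "?k \<in> borel_measurable (N \<Otimes>\<^sub>M N)" by measurable
    have ki: "integrable (distr M N U \<Otimes>\<^sub>M distr M N V) ?k"
      by (rule Bochner_Integration.integrable_bound[OF intf]) (auto simp: indicator_def)
    have "(\<integral>\<omega>\<in>A. f (U \<omega>, V \<omega>) \<partial>M) = (\<integral>\<omega>. ?k (U \<omega>, V \<omega>) \<partial>M)"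
      unfolding set_lebesgue_integral_def by (rule Bochner_Integration.integral_cong) (auto simp: iA)
    also have "\<dots> = (\<integral>z. ?k z \<partial>(distr M N U \<Otimes>\<^sub>M distr M N V))"
      unfolding d[symmetric] by (subst integral_distr) auto
    also have "\<dots> = (\<integral>u. (\<integral>v. ?k (u, v) \<partial>distr M N V) \<partial>distr M N U)"
      by (rule P.integral_fst'[OF ki, symmetric])
    also have "\<dots> = (\<integral>u. indicator S u * g u \<partial>distr M N U)"
      by (simp add: g_def)
    also have "\<dots> = (\<integral>\<omega>. indicator S (U \<omega>) * g (U \<omega>) \<partial>M)"
      by (subst integral_distr) auto
    also have "\<dots> = (\<integral>\<omega>\<in>A. g (U \<omega>) \<partial>M)"
      unfolding set_lebesgue_integral_def by (rule Bochner_Integration.integral_cong) (auto simp: iA)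
    finally show "(\<integral>\<omega>\<in>A. f (U \<omega>, V \<omega>) \<partial>M) = (\<integral>\<omega>\<in>A. g (U \<omega>) \<partial>M)" .
  qed
  then show ?thesis by (simp add: g_def)
qed

section \<open>Double centring with respect to a probability law\<close>

lemma (in prob_space) distr_pair_snd: "distr (M \<Otimes>\<^sub>M M) M snd = M"
proof -
  interpret P: pair_prob_space M M ..
  have "distr (M \<Otimes>\<^sub>M M) M snd = distr (distr (M \<Otimes>\<^sub>M M) (M \<Otimes>\<^sub>M M) (\<lambda>(x, y). (y, x))) M snd"
    using P.distr_pair_swap by simp
  also have "\<dots> = distr (M \<Otimes>\<^sub>M M) M fst"
    by (subst distr_distr) (auto simp: comp_def split_beta)
  finally show ?thesis by (simp add: distr_pair_fst)
qed

text \<open>Both one-variable terms integrate out the second argument, which is the usual double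
  centring when f is symmetric.\<close>

definition double_center :: "'b measure \<Rightarrow> ('b \<times> 'b \<Rightarrow> real) \<Rightarrow> 'b \<times> 'b \<Rightarrow> real" where
  "double_center \<nu> f z = f z - (\<integral>y. f (fst z, y) \<partial>\<nu>) - (\<integral>y. f (snd z, y) \<partial>\<nu>) + (\<integral>x. (\<integral>y. f (x, y) \<partial>\<nu>) \<partial>\<nu>)"

text \<open>A sum of four terms costs the factor 64 = 8 * 8 in the fourth power, and by Jensen each
  term has fourth moment at most that of f; hence 256. Integrability of every single section is
  assumed, as Fubini would give degeneracy only almost everywhere.\<close>

lemma (in prob_space)
  fixes f :: "'a \<times> 'a \<Rightarrow> real"
  assumes f [measurable]: "f \<in> borel_measurable (M \<Otimes>\<^sub>M M)" and sym: "\<And>x y. f (x, y) = f (y, x)"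
    and f4: "integrable (M \<Otimes>\<^sub>M M) (\<lambda>z. f z ^ 4)"
    and sec: "\<And>x. x \<in> space M \<Longrightarrow> integrable M (\<lambda>y. f (x, y) ^ 4)"
  shows degenerate_kernel_double_center: "degenerate_kernel M (double_center M f)"
    and double_center_fourth_le:
      "(\<integral>z. double_center M f z ^ 4 \<partial>(M \<Otimes>\<^sub>M M)) \<le> 256 * (\<integral>z. f z ^ 4 \<partial>(M \<Otimes>\<^sub>M M))"
proof -
  interpret P: pair_prob_space M M ..
  define G where "G = (\<lambda>x. \<integral>y. f (x, y) \<partial>M)"
  define F4 where "F4 = (\<integral>z. f z ^ 4 \<partial>(M \<Otimes>\<^sub>M M))"
  have [measurable]: "G \<in> borel_measurable M" unfolding G_def by measurable
  have dc: "double_center M f = (\<lambda>z. f z - G (fst z) - G (snd z) + expectation G)"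
    by (simp add: double_center_def G_def fun_eq_iff)
  have secm [measurable]: "(\<lambda>y. f (x, y)) \<in> borel_measurable M" if "x \<in> space M" for x
    using that by measurable
  have H: "integrable M (\<lambda>x. \<integral>y. f (x, y) ^ 4 \<partial>M)" "(\<integral>x. \<integral>y. f (x, y) ^ 4 \<partial>M \<partial>M) = F4"
    using P.integrable_fst'[OF f4] P.integral_fst'[OF f4] by (simp_all add: F4_def)
  have GH: "G x ^ 4 \<le> (\<integral>y. f (x, y) ^ 4 \<partial>M)" if "x \<in> space M" for x
    unfolding G_def by (rule expectation_fourth_le[OF sec[OF that] secm[OF that]])
  have G4: "integrable M (\<lambda>x. G x ^ 4)"
    by (rule integrable_fourth_bound[OF H(1) _ GH]) measurable
  have EG4: "expectation (\<lambda>x. G x ^ 4) \<le> F4"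
    unfolding H(2)[symmetric] by (intro integral_mono G4 H(1) GH)
  have c4: "(expectation G) ^ 4 \<le> F4"
    by (rule order_trans[OF expectation_fourth_le[OF G4] EG4]) measurable
  have dfst: "distr (M \<Otimes>\<^sub>M M) M fst = M" by (simp add: distr_pair_fst)
  have dsnd: "distr (M \<Otimes>\<^sub>M M) M snd = M" by (rule distr_pair_snd)
  have fst4: "integrable (M \<Otimes>\<^sub>M M) (\<lambda>z. G (fst z) ^ 4)" "(\<integral>z. G (fst z) ^ 4 \<partial>(M \<Otimes>\<^sub>M M)) = expectation (\<lambda>x. G x ^ 4)"
    using integrable_distr_eq[of fst "M \<Otimes>\<^sub>M M" M "\<lambda>x. G x ^ 4"] integral_distr[of fst "M \<Otimes>\<^sub>M M" M "\<lambda>x. G x ^ 4"] G4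
    by (simp_all add: dfst)
  have snd4: "integrable (M \<Otimes>\<^sub>M M) (\<lambda>z. G (snd z) ^ 4)" "(\<integral>z. G (snd z) ^ 4 \<partial>(M \<Otimes>\<^sub>M M)) = expectation (\<lambda>x. G x ^ 4)"
    using integrable_distr_eq[of snd "M \<Otimes>\<^sub>M M" M "\<lambda>x. G x ^ 4"] integral_distr[of snd "M \<Otimes>\<^sub>M M" M "\<lambda>x. G x ^ 4"] G4
    by (simp_all add: dsnd)
  let ?b = "\<lambda>z. 64 * (f z ^ 4 + G (fst z) ^ 4 + G (snd z) ^ 4 + (expectation G) ^ 4)"
  have b: "integrable (M \<Otimes>\<^sub>M M) ?b" using f4 fst4(1) snd4(1) by simp
  have le: "double_center M f z ^ 4 \<le> ?b z" for z
  proof -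
    have "double_center M f z ^ 4 = ((f z + - G (fst z)) + (- G (snd z) + expectation G)) ^ 4"
      unfolding dc by (rule arg_cong[of _ _ "\<lambda>x. x ^ 4"]) simp
    also have "\<dots> \<le> 8 * ((f z + - G (fst z)) ^ 4 + (- G (snd z) + expectation G) ^ 4)"
      by (rule fourth_power_add_le)
    also have "\<dots> \<le> 8 * (8 * (f z ^ 4 + (- G (fst z)) ^ 4) + 8 * ((- G (snd z)) ^ 4 + (expectation G) ^ 4))"
      by (intro mult_left_mono add_mono fourth_power_add_le) simp
    finally show ?thesis by simp
  qed
  have m [measurable]: "double_center M f \<in> borel_measurable (M \<Otimes>\<^sub>M M)" unfolding dc by measurable
  have dc4: "integrable (M \<Otimes>\<^sub>M M) (\<lambda>z. double_center M f z ^ 4)"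
    by (rule integrable_fourth_bound[OF b m le])
  have Gi: "integrable M G" by (rule integrable_of_fourth[OF G4]) measurable
  have "(\<integral>y. double_center M f (x, y) \<partial>M) = 0" if x: "x \<in> space M" for x
  proof -
    have "integrable M (\<lambda>y. f (x, y))" by (rule integrable_of_fourth[OF sec[OF x] secm[OF x]])
    then show ?thesis using Gi by (simp add: dc prob_space) (simp add: G_def)
  qed
  with dc4 m sym show "degenerate_kernel M (double_center M f)"
    by (auto simp: degenerate_kernel_def dc)
  have "(\<integral>z. double_center M f z ^ 4 \<partial>(M \<Otimes>\<^sub>M M)) \<le> (\<integral>z. ?b z \<partial>(M \<Otimes>\<^sub>M M))"
    by (intro integral_mono dc4 b le)
  also have "\<dots> = 64 * (F4 + expectation (\<lambda>x. G x ^ 4) + expectation (\<lambda>x. G x ^ 4) + (expectation G) ^ 4)"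
    using f4 fst4 snd4 by (simp add: F4_def P.prob_space)
  also have "\<dots> \<le> 64 * (F4 + F4 + F4 + F4)"
    by (intro mult_left_mono add_mono EG4 c4) auto
  finally show "(\<integral>z. double_center M f z ^ 4 \<partial>(M \<Otimes>\<^sub>M M)) \<le> 256 * (\<integral>z. f z ^ 4 \<partial>(M \<Otimes>\<^sub>M M))"
    by (simp add: F4_def)
qed

text \<open>The constant enters the four terms with signs adding up to 0; integrability is what
  allows the integrals to be split.\<close>

lemma (in prob_space) double_center_diff_const:
  fixes f :: "'a \<times> 'a \<Rightarrow> real"
  assumes "\<And>x. x \<in> space M \<Longrightarrow> integrable M (\<lambda>y. f (x, y))" "integrable M (\<lambda>x. \<integral>y. f (x, y) \<partial>M)"
    and z: "z \<in> space (M \<Otimes>\<^sub>M M)"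
  shows "double_center M (\<lambda>z. f z - c) z = double_center M f z"
proof -
  have "(\<integral>x. (\<integral>y. f (x, y) - c \<partial>M) \<partial>M) = (\<integral>x. (\<integral>y. f (x, y) \<partial>M) - c \<partial>M)"
    using assms by (intro Bochner_Integration.integral_cong refl) (simp add: prob_space)
  then show ?thesis
    using assms z by (auto simp: double_center_def prob_space space_pair_measure)
qed

section \<open>Laws of random vectors\<close>

lemma vnorm_nonneg [simp]: "0 \<le> vnorm p x"
  by (simp add: vnorm_def L2_set_nonneg)

lemma vnorm_power2: "(vnorm p x)\<^sup>2 = (\<Sum>j<p. (x j)\<^sup>2)"
  by (simp add: vnorm_def L2_set_def sum_nonneg)

lemma vdist_nonneg [simp]: "0 \<le> vdist p x y"
  by (simp add: vdist_def)

lemma vdist_self [simp]: "vdist p x x = 0"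
  by (simp add: vdist_def vnorm_def L2_set_def)

lemma vdist_commute: "vdist p x y = vdist p y x"
  by (simp add: vdist_def vnorm_def L2_set_def power2_commute)

lemma vdist_power2: "(vdist p x y)\<^sup>2 = (vnorm p x)\<^sup>2 + (vnorm p y)\<^sup>2 - 2 * vinner p x y"
  unfolding vdist_def vnorm_power2
  by (simp add: vinner_def power2_diff sum.distrib sum_subtractf sum_distrib_left mult.assoc)

lemma vdist_le: "vdist p x y \<le> vnorm p x + vnorm p y"
  using L2_set_triangle_ineq[of x "\<lambda>j. - y j" "{..<p}"]
  by (simp add: vdist_def vnorm_def L2_set_def)

lemma abs_vinner_le: "\<bar>vinner p x y\<bar> \<le> ((vnorm p x)\<^sup>2 + (vnorm p y)\<^sup>2) / 2"
proof -
  have "\<bar>vinner p x y\<bar> \<le> (\<Sum>j<p. \<bar>x j * y j\<bar>)" unfolding vinner_def by (rule sum_abs)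
  also have "\<dots> \<le> (\<Sum>j<p. ((x j)\<^sup>2 + (y j)\<^sup>2) / 2)" by (intro sum_mono abs_mult_le_half_squares)
  finally show ?thesis by (simp add: vnorm_power2 sum.distrib flip: sum_divide_distrib)
qed

lemma measurable_vec_component [measurable]: "j < p \<Longrightarrow> (\<lambda>x. x j) \<in> borel_measurable (vec_borel p)"
  by (rule measurable_component_singleton) simp

lemma measurable_vnorm [measurable]: "vnorm p \<in> borel_measurable (vec_borel p)"
  unfolding vnorm_def[abs_def] L2_set_def by measurable

lemma measurable_vinner [measurable]:
  "(\<lambda>z. vinner p (fst z) (snd z)) \<in> borel_measurable (vec_borel p \<Otimes>\<^sub>M vec_borel p)"
  unfolding vinner_def by measurable

lemma measurable_vdist [measurable]:
  "(\<lambda>z. vdist p (fst z) (snd z)) \<in> borel_measurable (vec_borel p \<Otimes>\<^sub>M vec_borel p)"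
  unfolding vdist_def vnorm_def L2_set_def by measurable

abbreviation (input) pair_dist :: "nat \<Rightarrow> rvec \<times> rvec \<Rightarrow> real" where
  "pair_dist p z \<equiv> vdist p (fst z) (snd z)"

text \<open>Distances are controlled by fourth moments of the norm; the eighth moment gives fourth
  moments of squared norms and inner products, that is, finiteness of L.\<close>

locale vec_law = prob_space \<nu> for \<nu> :: "rvec measure" +
  fixes p :: nat
  assumes sets_law [measurable_cong]: "sets \<nu> = sets (vec_borel p)"
    and moment8: "integrable \<nu> (\<lambda>x. vnorm p x ^ 8)"
begin

sublocale P: pair_prob_space \<nu> \<nu> ..

lemma
  fixes g :: "rvec \<Rightarrow> real"
  assumes [measurable]: "g \<in> borel_measurable \<nu>"
  shows integrable_fst_iff: "integrable (\<nu> \<Otimes>\<^sub>M \<nu>) (\<lambda>z. g (fst z)) \<longleftrightarrow> integrable \<nu> g"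
    and integral_fst_eq: "(\<integral>z. g (fst z) \<partial>(\<nu> \<Otimes>\<^sub>M \<nu>)) = expectation g"
    and integrable_snd_iff: "integrable (\<nu> \<Otimes>\<^sub>M \<nu>) (\<lambda>z. g (snd z)) \<longleftrightarrow> integrable \<nu> g"
    and integral_snd_eq: "(\<integral>z. g (snd z) \<partial>(\<nu> \<Otimes>\<^sub>M \<nu>)) = expectation g"
  using integrable_distr_eq[of fst "\<nu> \<Otimes>\<^sub>M \<nu>" \<nu> g] integral_distr[of fst "\<nu> \<Otimes>\<^sub>M \<nu>" \<nu> g]
    integrable_distr_eq[of snd "\<nu> \<Otimes>\<^sub>M \<nu>" \<nu> g] integral_distr[of snd "\<nu> \<Otimes>\<^sub>M \<nu>" \<nu> g]
  by (simp_all add: distr_pair_fst distr_pair_snd)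

lemma moment4: "integrable \<nu> (\<lambda>x. vnorm p x ^ 4)"
proof -
  have "integrable \<nu> (\<lambda>x. ((vnorm p x)\<^sup>2)\<^sup>2)"
    by (rule integrable_square_of_fourth) (use moment8 in simp_all)
  then show ?thesis by simp
qed

lemma moment2: "integrable \<nu> (\<lambda>x. (vnorm p x)\<^sup>2)"
  by (rule integrable_square_of_fourth[OF moment4]) measurable

lemma measurable_pair_dist_law [measurable]: "pair_dist p \<in> borel_measurable (\<nu> \<Otimes>\<^sub>M \<nu>)"
  by measurable

lemma measurable_section_dist: "x \<in> space \<nu> \<Longrightarrow> (\<lambda>y. vdist p x y) \<in> borel_measurable \<nu>"
  using measurable_Pair2[OF measurable_pair_dist_law] by simp

lemma dist4_le: "(vdist p x y - s) ^ 4 \<le> 64 * (vnorm p x ^ 4 + vnorm p y ^ 4 + s ^ 4)"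
proof -
  have "(vdist p x y - s) ^ 4 \<le> 8 * (vdist p x y ^ 4 + s ^ 4)"
    using fourth_power_add_le[of "vdist p x y" "- s"] by simp
  also have "\<dots> \<le> 8 * ((vnorm p x + vnorm p y) ^ 4 + s ^ 4)"
    by (intro mult_left_mono add_right_mono power_mono vdist_le) auto
  also have "\<dots> \<le> 8 * (8 * (vnorm p x ^ 4 + vnorm p y ^ 4) + s ^ 4)"
    by (intro mult_left_mono add_right_mono fourth_power_add_le) auto
  also have "\<dots> \<le> 64 * (vnorm p x ^ 4 + vnorm p y ^ 4 + s ^ 4)"
    by simp
  finally show ?thesis .
qed

lemma integrable_dist4: "integrable (\<nu> \<Otimes>\<^sub>M \<nu>) (\<lambda>z. (pair_dist p z - s) ^ 4)"
proof (rule integrable_fourth_bound)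
  show "integrable (\<nu> \<Otimes>\<^sub>M \<nu>) (\<lambda>z. 64 * (vnorm p (fst z) ^ 4 + vnorm p (snd z) ^ 4 + s ^ 4))"
    using moment4 integrable_fst_iff[of "\<lambda>x. vnorm p x ^ 4"] integrable_snd_iff[of "\<lambda>x. vnorm p x ^ 4"] by simp
qed (use dist4_le in measurable)

lemma integrable_section_dist4:
  assumes x: "x \<in> space \<nu>"
  shows "integrable \<nu> (\<lambda>y. (vdist p x y - s) ^ 4)"
proof (rule integrable_fourth_bound)
  show "integrable \<nu> (\<lambda>y. 64 * (vnorm p x ^ 4 + vnorm p y ^ 4 + s ^ 4))"
    using moment4 by simp
  show "(\<lambda>y. vdist p x y - s) \<in> borel_measurable \<nu>"
    using measurable_section_dist[OF x] by measurable
qed (rule dist4_le)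

lemma integrable_dist: "integrable (\<nu> \<Otimes>\<^sub>M \<nu>) (pair_dist p)"
  using P.integrable_of_fourth[OF integrable_dist4[of 0, simplified]] by simp

lemma integrable_section_dist: "x \<in> space \<nu> \<Longrightarrow> integrable \<nu> (vdist p x)"
  using integrable_of_fourth[OF integrable_section_dist4[of x 0, simplified]] measurable_section_dist by blast

section \<open>The double-centred distance kernel\<close>

definition dist_kernel :: "rvec \<times> rvec \<Rightarrow> real" where
  "dist_kernel = double_center \<nu> (pair_dist p)"

lemma dist_kernel_shift:
  assumes "z \<in> space (\<nu> \<Otimes>\<^sub>M \<nu>)"
  shows "dist_kernel z = double_center \<nu> (\<lambda>z. pair_dist p z - s) z"
  unfolding dist_kernel_def
  by (rule double_center_diff_const[symmetric])
     (use integrable_section_dist P.integrable_fst'[OF integrable_dist] assms in simp_all)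

lemma degenerate_dist_kernel: "degenerate_kernel \<nu> dist_kernel"
  unfolding dist_kernel_def
  by (rule degenerate_kernel_double_center)
     (use integrable_dist4[of 0] integrable_section_dist4[of _ 0] vdist_commute in auto)

lemma dist_kernel_fourth_le:
  "(\<integral>z. dist_kernel z ^ 4 \<partial>(\<nu> \<Otimes>\<^sub>M \<nu>)) \<le> 256 * (\<integral>z. (pair_dist p z - s) ^ 4 \<partial>(\<nu> \<Otimes>\<^sub>M \<nu>))"
proof -
  have "(\<integral>z. dist_kernel z ^ 4 \<partial>(\<nu> \<Otimes>\<^sub>M \<nu>)) = (\<integral>z. double_center \<nu> (\<lambda>z. pair_dist p z - s) z ^ 4 \<partial>(\<nu> \<Otimes>\<^sub>M \<nu>))"
    by (intro Bochner_Integration.integral_cong refl) (simp only: dist_kernel_shift[of _ s])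
  also have "\<dots> \<le> 256 * (\<integral>z. (pair_dist p z - s) ^ 4 \<partial>(\<nu> \<Otimes>\<^sub>M \<nu>))"
    by (rule double_center_fourth_le)
       (use integrable_dist4[of s] integrable_section_dist4[of _ s] in \<open>auto simp: vdist_commute\<close>)
  finally show ?thesis .
qed

lemma
  shows integrable_norm_dev4: "integrable \<nu> (\<lambda>x. ((vnorm p x)\<^sup>2 - c) ^ 4)"
    and integrable_inner4: "integrable (\<nu> \<Otimes>\<^sub>M \<nu>) (\<lambda>z. vinner p (fst z) (snd z) ^ 4)"
proof -
  show "integrable \<nu> (\<lambda>x. ((vnorm p x)\<^sup>2 - c) ^ 4)"
  proof (rule integrable_fourth_bound)
    show "integrable \<nu> (\<lambda>x. 8 * (vnorm p x ^ 8 + c ^ 4))" using moment8 by simp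
    show "((vnorm p x)\<^sup>2 - c) ^ 4 \<le> 8 * (vnorm p x ^ 8 + c ^ 4)" for x
      using fourth_power_add_le[of "(vnorm p x)\<^sup>2" "- c"] by simp
  qed measurable
  show "integrable (\<nu> \<Otimes>\<^sub>M \<nu>) (\<lambda>z. vinner p (fst z) (snd z) ^ 4)"
  proof (rule integrable_fourth_bound)
    show "integrable (\<nu> \<Otimes>\<^sub>M \<nu>) (\<lambda>z. vnorm p (fst z) ^ 8 + vnorm p (snd z) ^ 8)"
      using moment8 integrable_fst_iff[of "\<lambda>x. vnorm p x ^ 8"] integrable_snd_iff[of "\<lambda>x. vnorm p x ^ 8"] by simp
    show "vinner p (fst z) (snd z) ^ 4 \<le> vnorm p (fst z) ^ 8 + vnorm p (snd z) ^ 8" for z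
    proof -
      let ?x = "fst z" and ?y = "snd z"
      have "\<bar>vinner p ?x ?y\<bar> ^ 4 \<le> (((vnorm p ?x)\<^sup>2 + (vnorm p ?y)\<^sup>2) / 2) ^ 4"
        by (intro power_mono abs_vinner_le) simp
      also have "\<dots> = ((vnorm p ?x)\<^sup>2 + (vnorm p ?y)\<^sup>2) ^ 4 / 16"
        by (simp add: power_divide)
      also have "\<dots> \<le> 8 * (((vnorm p ?x)\<^sup>2) ^ 4 + ((vnorm p ?y)\<^sup>2) ^ 4) / 16"
        by (intro divide_right_mono fourth_power_add_le) simp
      also have "\<dots> \<le> vnorm p ?x ^ 8 + vnorm p ?y ^ 8" by simp
      finally show ?thesis by simp
    qed
  qed measurable
qed

text \<open>Integrating one vector out first leaves a linear form in its coordinate means. This is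
  where the zero means enter: they give B = 2 E|X|^2, so that dist^2 - B splits into the two centred
  squared norms and the inner product.\<close>

lemma integral_inner_eq_0:
  assumes mean: "\<And>j. j < p \<Longrightarrow> (\<integral>x. x j \<partial>\<nu>) = 0"
  shows "(\<integral>z. vinner p (fst z) (snd z) \<partial>(\<nu> \<Otimes>\<^sub>M \<nu>)) = 0"
proof -
  have int: "integrable (\<nu> \<Otimes>\<^sub>M \<nu>) (\<lambda>z. vinner p (fst z) (snd z))"
    by (rule P.integrable_of_fourth[OF integrable_inner4]) measurable
  have cint: "integrable \<nu> (\<lambda>x. x j)" if j: "j < p" for j
  proof -
    have "integrable \<nu> (\<lambda>x. (x j)\<^sup>2)"
    proof (rule Bochner_Integration.integrable_bound[OF moment2])
      have "(x j)\<^sup>2 \<le> (vnorm p x)\<^sup>2" for x :: rvec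
        unfolding vnorm_power2 by (rule member_le_sum) (use j in auto)
      then show "AE x in \<nu>. norm ((x j)\<^sup>2) \<le> norm ((vnorm p x)\<^sup>2)" by simp
    qed (use j in measurable)
    then show ?thesis
      using integrable_mult_of_squares[of \<nu> "\<lambda>x. x j" "\<lambda>_. 1"] j by simp
  qed
  have "(\<integral>z. vinner p (fst z) (snd z) \<partial>(\<nu> \<Otimes>\<^sub>M \<nu>)) = (\<integral>x. (\<integral>y. vinner p x y \<partial>\<nu>) \<partial>\<nu>)"
    using P.integral_fst'[OF int] by simp
  also have "\<dots> = (\<integral>x. 0 \<partial>\<nu>)"
    unfolding vinner_def using cint mean
    by (intro Bochner_Integration.integral_cong refl) (subst Bochner_Integration.integral_sum, auto)
  finally show ?thesis by simp
qed

lemma mean_square_dist: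
  assumes "\<And>j. j < p \<Longrightarrow> (\<integral>x. x j \<partial>\<nu>) = 0"
  shows "(\<integral>z. (pair_dist p z)\<^sup>2 \<partial>(\<nu> \<Otimes>\<^sub>M \<nu>)) = 2 * expectation (\<lambda>x. (vnorm p x)\<^sup>2)"
proof -
  have "integrable (\<nu> \<Otimes>\<^sub>M \<nu>) (\<lambda>z. vinner p (fst z) (snd z))"
    by (rule P.integrable_of_fourth[OF integrable_inner4]) measurable
  then show ?thesis
    unfolding vdist_power2
    using integral_inner_eq_0[OF assms] moment2 integrable_fst_iff[of "\<lambda>x. (vnorm p x)\<^sup>2"]
      integrable_snd_iff[of "\<lambda>x. (vnorm p x)\<^sup>2"] integral_fst_eq[of "\<lambda>x. (vnorm p x)\<^sup>2"]
      integral_snd_eq[of "\<lambda>x. (vnorm p x)\<^sup>2"]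
    by simp
qed

text \<open>
  Double centring annihilates constants, so the distance may be replaced by its deviation from
  \<open>sqrt B\<close>, which is at most \<open>\<bar>dist\<^sup>2 - B\<bar> / sqrt B\<close>; and \<open>dist\<^sup>2 - B\<close> is made of the centred
  squared norms and an inner product, whose fourth moments add up to \<open>L\<close>.
\<close>

lemma dist_kernel_fourth_bound:
  fixes B L :: real
  defines "m \<equiv> expectation (\<lambda>x. (vnorm p x)\<^sup>2)"
  defines "B \<equiv> (\<integral>z. (pair_dist p z)\<^sup>2 \<partial>(\<nu> \<Otimes>\<^sub>M \<nu>))"
  defines "L \<equiv> expectation (\<lambda>x. ((vnorm p x)\<^sup>2 - m) ^ 4) + (\<integral>z. vinner p (fst z) (snd z) ^ 4 \<partial>(\<nu> \<Otimes>\<^sub>M \<nu>))"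
  assumes mean: "\<And>j. j < p \<Longrightarrow> (\<integral>x. x j \<partial>\<nu>) = 0" and B: "B > 0"
  shows "(\<integral>z. dist_kernel z ^ 4 \<partial>(\<nu> \<Otimes>\<^sub>M \<nu>)) \<le> 32768 * L / B\<^sup>2"
proof -
  define s where "s = sqrt B"
  have s: "s > 0" "s\<^sup>2 = B" using B by (simp_all add: s_def)
  have Bm: "B = 2 * m" unfolding B_def m_def by (rule mean_square_dist[OF mean])
  let ?b = "\<lambda>z. 64 / B\<^sup>2 * (((vnorm p (fst z))\<^sup>2 - m) ^ 4 + ((vnorm p (snd z))\<^sup>2 - m) ^ 4
      + 2 * vinner p (fst z) (snd z) ^ 4)"
  have le: "(pair_dist p z - s) ^ 4 \<le> ?b z" for z
  proof -
    let ?a = "pair_dist p z" and ?u = "(vnorm p (fst z))\<^sup>2 - m" and ?w = "(vnorm p (snd z))\<^sup>2 - m"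
      and ?t = "vinner p (fst z) (snd z)"
    have a0: "0 \<le> ?a" by simp
    have "\<bar>?a - s\<bar> * s \<le> \<bar>?a - s\<bar> * (?a + s)"
      using a0 s by (intro mult_left_mono) auto
    also have "\<dots> = \<bar>(?a - s) * (?a + s)\<bar>" using a0 s by (simp add: abs_mult)
    also have "(?a - s) * (?a + s) = ?a\<^sup>2 - B" by (simp add: s(2)[symmetric] power2_eq_square algebra_simps)
    finally have "(\<bar>?a - s\<bar> * s) ^ 4 \<le> \<bar>?a\<^sup>2 - B\<bar> ^ 4" by (rule power_mono) (use s in simp)
    then have "(?a - s) ^ 4 * B\<^sup>2 \<le> (?a\<^sup>2 - B) ^ 4"
      by (simp add: power_mult_distrib flip: s(2))
    also have "?a\<^sup>2 - B = (?u + ?w) + (- 2 * ?t)" by (simp add: vdist_power2 Bm)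
    also have "\<dots> ^ 4 \<le> 8 * ((?u + ?w) ^ 4 + (- 2 * ?t) ^ 4)" by (rule fourth_power_add_le)
    also have "\<dots> \<le> 8 * (8 * (?u ^ 4 + ?w ^ 4) + (- 2 * ?t) ^ 4)"
      by (intro mult_left_mono add_mono fourth_power_add_le) auto
    also have "\<dots> = 64 * (?u ^ 4 + ?w ^ 4 + 2 * ?t ^ 4)" by (simp add: power_mult_distrib)
    finally show ?thesis using B by (simp add: pos_le_divide_eq)
  qed
  note u = integrable_norm_dev4[of m]
  have bint: "integrable (\<nu> \<Otimes>\<^sub>M \<nu>) ?b"
    using u integrable_inner4 integrable_fst_iff[of "\<lambda>x. ((vnorm p x)\<^sup>2 - m) ^ 4"]
      integrable_snd_iff[of "\<lambda>x. ((vnorm p x)\<^sup>2 - m) ^ 4"] by simp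
  have "(\<integral>z. dist_kernel z ^ 4 \<partial>(\<nu> \<Otimes>\<^sub>M \<nu>)) \<le> 256 * (\<integral>z. (pair_dist p z - s) ^ 4 \<partial>(\<nu> \<Otimes>\<^sub>M \<nu>))"
    by (rule dist_kernel_fourth_le)
  also have "\<dots> \<le> 256 * (\<integral>z. ?b z \<partial>(\<nu> \<Otimes>\<^sub>M \<nu>))"
    by (intro mult_left_mono integral_mono integrable_dist4 bint le) auto
  \<comment> \<open>The two norm deviations have the same law, so the bracket integrates to 2
    \<open>L\<close>; together with the 256 of double centring this gives 256 * 64 * 2 =
    32768.\<close>
  also have "(\<integral>z. ?b z \<partial>(\<nu> \<Otimes>\<^sub>M \<nu>)) = 64 / B\<^sup>2 * (2 * L)"
    using u integrable_inner4 integrable_fst_iff[of "\<lambda>x. ((vnorm p x)\<^sup>2 - m) ^ 4"]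
      integrable_snd_iff[of "\<lambda>x. ((vnorm p x)\<^sup>2 - m) ^ 4"] integral_fst_eq[of "\<lambda>x. ((vnorm p x)\<^sup>2 - m) ^ 4"]
      integral_snd_eq[of "\<lambda>x. ((vnorm p x)\<^sup>2 - m) ^ 4"]
    by (simp add: L_def)
  finally show ?thesis by simp
qed

end

section \<open>Samples of random vectors\<close>

lemma (in iid_sample) iid_sample_map:
  assumes [measurable]: "\<phi> \<in> measurable \<mu> N"
  shows "iid_sample M (\<lambda>i \<omega>. \<phi> (Z i \<omega>)) (distr \<mu> N \<phi>) n"
proof (intro iid_sample.intro iid_sample_axioms.intro prob_space_axioms)
  show "indep_vars (\<lambda>_. distr \<mu> N \<phi>) (\<lambda>i \<omega>. \<phi> (Z i \<omega>)) {1..n}"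
    by (rule indep_vars_compose2[OF indep]) simp
  show "distr M (distr \<mu> N \<phi>) (\<lambda>\<omega>. \<phi> (Z i \<omega>)) = distr \<mu> N \<phi>" if i: "i \<in> {1..n}" for i
  proof -
    have "distr M (distr \<mu> N \<phi>) (\<lambda>\<omega>. \<phi> (Z i \<omega>)) = distr M N (\<phi> \<circ> Z i)"
      by (intro distr_cong) auto
    also have "\<dots> = distr (distr M \<mu> (Z i)) N \<phi>"
      using i by (intro distr_distr[symmetric]) auto
    finally show ?thesis by (simp add: distr_Z[OF i])
  qed
  show "prob_space (distr \<mu> N \<phi>)" by (rule mu.prob_space_distr) measurable
qed

text \<open>\<open>\<phi>\<close> picks one half of each observation. Distances are studied under
  the law of that half; the kernel is then pulled back to whole observations, so that the kernels of
  both halves live over the same sample and can be multiplied.\<close>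

locale vec_component = iid_sample M Z \<mu> n
  for M :: "'a measure" and Z :: "nat \<Rightarrow> 'a \<Rightarrow> 'b" and \<mu> n +
  fixes \<phi> :: "'b \<Rightarrow> rvec" and p :: nat
  assumes n4: "4 \<le> n"
    and measurable_component [measurable]: "\<phi> \<in> measurable \<mu> (vec_borel p)"
    and component_moment8: "integrable \<mu> (\<lambda>z. vnorm p (\<phi> z) ^ 8)"
begin

definition copies :: "nat \<Rightarrow> 'a \<Rightarrow> rvec" where "copies i \<omega> = \<phi> (Z i \<omega>)"

abbreviation law :: "rvec measure" where "law \<equiv> distr \<mu> (vec_borel p) \<phi>"

sublocale S: iid_sample M copies law n
  unfolding copies_def[abs_def] by (rule iid_sample_map) measurable

sublocale law: vec_law law p
proof
  show "integrable law (\<lambda>x. vnorm p x ^ 8)"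
    by (subst integrable_distr_eq) (use component_moment8 in measurable)
qed simp

definition kernel :: "'b \<times> 'b \<Rightarrow> real" where
  "kernel z = law.dist_kernel (\<phi> (fst z), \<phi> (snd z))"

lemma one_two: "1 \<in> {1..n}" "2 \<in> {1..n}" "(1::nat) \<noteq> 2"
  using n4 by auto

lemma measurable_dist_kernel [measurable]: "law.dist_kernel \<in> borel_measurable (law \<Otimes>\<^sub>M law)"
  by (rule degenerate_kernelD(2)[OF law.degenerate_dist_kernel])

lemma measurable_kernel [measurable]: "kernel \<in> borel_measurable (\<mu> \<Otimes>\<^sub>M \<mu>)"
proof -
  have "(\<lambda>z. (\<phi> (fst z), \<phi> (snd z))) \<in> measurable (\<mu> \<Otimes>\<^sub>M \<mu>) (law \<Otimes>\<^sub>M law)" by measurable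
  from measurable_compose[OF this measurable_dist_kernel] show ?thesis
    by (simp add: kernel_def[abs_def])
qed

lemma kernel_Z: "kernel (Z k \<omega>, Z l \<omega>) = law.dist_kernel (copies k \<omega>, copies l \<omega>)"
  by (simp add: kernel_def copies_def)

lemma degenerate_kernel_component: "degenerate_kernel \<mu> kernel"
  unfolding degenerate_kernel_def
proof (intro conjI allI ballI)
  note D = degenerate_kernelD[OF law.degenerate_dist_kernel]
  \<comment> \<open>The original and the pulled-back kernel are compared on \<open>M\<close>, where
    both are evaluated at the sample members 1 and 2.\<close>
  have "integrable M (\<lambda>\<omega>. law.dist_kernel (copies 1 \<omega>, copies 2 \<omega>) ^ 4)"
    using S.integrable_pair[OF one_two, of "\<lambda>z. law.dist_kernel z ^ 4"] D(1) by simp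
  then show "integrable (\<mu> \<Otimes>\<^sub>M \<mu>) (\<lambda>z. kernel z ^ 4)"
    using integrable_pair[OF one_two, of "\<lambda>z. kernel z ^ 4"] by (simp add: kernel_Z)
  show "kernel (x, y) = kernel (y, x)" for x y
    unfolding kernel_def by (simp add: D(3)[of "\<phi> x"])
  show "(\<integral>y. kernel (x, y) \<partial>\<mu>) = 0" if x: "x \<in> space \<mu>" for x
  proof -
    have \<phi>x: "\<phi> x \<in> space law" using measurable_space[OF measurable_component x] by simp
    have m: "(\<lambda>y. law.dist_kernel (\<phi> x, y)) \<in> borel_measurable law"
      using measurable_Pair2[OF measurable_dist_kernel \<phi>x] .
    have "(\<integral>y. law.dist_kernel (\<phi> x, y) \<partial>law) = (\<integral>y. kernel (x, y) \<partial>\<mu>)"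
      unfolding kernel_def by (subst integral_distr) (use m in auto)
    with D(4)[OF \<phi>x] show ?thesis by simp
  qed
qed measurable

lemma kernel_at_eq:
  "kernel_at kernel k l \<omega> = (if k = l then 0 else vdist p (copies k \<omega>) (copies l \<omega>)
     - (\<integral>y. vdist p (copies k \<omega>) y \<partial>law) - (\<integral>y. vdist p (copies l \<omega>) y \<partial>law)
     + (\<integral>x. (\<integral>y. vdist p x y \<partial>law) \<partial>law))"
  unfolding kernel_at_def kernel_Z law.dist_kernel_def double_center_def by simp

text \<open>By independence each conditional expectation integrates out the other copy. Conditional
  expectations are fixed only up to null sets, and \<open>kernel\<close> supplies a version defined
  everywhere.\<close>

lemma ddist_eq: "AE \<omega> in M. ddist M p copies \<omega> = kernel (Z 1 \<omega>, Z 2 \<omega>)"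
  and measurable_ddist: "ddist M p copies \<in> borel_measurable M"
proof -
  let ?D = "\<lambda>\<omega>. vdist p (copies 1 \<omega>) (copies 2 \<omega>)"
  let ?F = "\<lambda>i. vimage_algebra (space M) (copies i) (vec_borel p)"
  have va: "vimage_algebra (space M) (copies i) law = ?F i" for i
    by (rule vimage_algebra_cong) auto
  have [measurable]: "copies 1 \<in> measurable M law" "copies 2 \<in> measurable M law"
    using one_two S.measurable_Z by auto
  have D: "integrable M ?D"
    using S.integrable_pair[OF one_two, of "pair_dist p"] law.integrable_dist by simp
  have "AE \<omega> in M. real_cond_exp M (vimage_algebra (space M) (copies 1) law)
      (\<lambda>\<omega>. pair_dist p (copies 1 \<omega>, copies 2 \<omega>)) \<omega>
      = (\<integral>v. pair_dist p (copies 1 \<omega>, v) \<partial>distr M law (copies 2))"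
    by (rule real_cond_exp_indep[OF S.indep_var_pair[OF one_two]]) (use D in auto)
  then have 1: "AE \<omega> in M. cond_exp_given M p (copies 1) ?D \<omega> = (\<integral>v. vdist p (copies 1 \<omega>) v \<partial>law)"
    unfolding cond_exp_given_def va S.distr_Z[OF one_two(2)] by simp
  \<comment> \<open>\<open>real_cond_exp_indep\<close> conditions on the first component, so the
    pair is swapped, which the symmetry of the distance permits.\<close>
  have "AE \<omega> in M. real_cond_exp M (vimage_algebra (space M) (copies 2) law)
      (\<lambda>\<omega>. pair_dist p (copies 2 \<omega>, copies 1 \<omega>)) \<omega>
      = (\<integral>v. pair_dist p (copies 2 \<omega>, v) \<partial>distr M law (copies 1))"
    by (rule real_cond_exp_indep[OF S.indep_var_pair[OF one_two(2,1) one_two(3)[symmetric]]])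
       (use D in \<open>auto simp: vdist_commute\<close>)
  then have 2: "AE \<omega> in M. cond_exp_given M p (copies 2) ?D \<omega> = (\<integral>v. vdist p (copies 2 \<omega>) v \<partial>law)"
    unfolding cond_exp_given_def va S.distr_Z[OF one_two(1)] by (simp add: vdist_commute)
  have 3: "expectation ?D = (\<integral>x. (\<integral>y. vdist p x y \<partial>law) \<partial>law)"
    using S.expectation_pair[OF one_two, of "pair_dist p"] S.mu2.integral_fst'[OF law.integrable_dist] by simp
  show "AE \<omega> in M. ddist M p copies \<omega> = kernel (Z 1 \<omega>, Z 2 \<omega>)"
    using 1 2
  proof eventually_elim
    case (elim \<omega>)
    then show ?case
      using kernel_at_eq[of 1 2 \<omega>] unfolding ddist_def Let_def by (simp add: kernel_at_def 3[unfolded One_nat_def])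
  qed
  \<comment> \<open>Equality almost everywhere does not transfer measurability unless
    \<open>M\<close> is complete; it is obtained instead from the sub-sigma-algebras of the
    conditional expectations.\<close>
  have sub: "subalgebra M (?F i)" if "copies i \<in> measurable M law" for i
    using that measurable_space[OF that]
    by (auto simp: subalgebra_def sets_vimage_algebra2 measurable_sets)
  have "real_cond_exp M (?F i) f \<in> borel_measurable M" if "copies i \<in> measurable M law" for i f
    by (rule measurable_from_subalg[OF sub[OF that]]) simp
  then show "ddist M p copies \<in> borel_measurable M"
    using D unfolding ddist_def[abs_def] Let_def cond_exp_given_def
    by (intro borel_measurable_add borel_measurable_diff borel_measurable_const) auto
qed

lemma ddist_moment4_eq: "ddist_moment4 M p copies = (\<integral>z. kernel z ^ 4 \<partial>(\<mu> \<Otimes>\<^sub>M \<mu>))"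
proof -
  have "ddist_moment4 M p copies = expectation (\<lambda>\<omega>. kernel (Z 1 \<omega>, Z 2 \<omega>) ^ 4)"
    unfolding ddist_moment4_def
    by (rule integral_cong_AE)
       (use ddist_eq measurable_ddist measurable_Z_pair[OF one_two(1,2)] in
        \<open>auto intro!: borel_measurable_power measurable_compose[OF _ measurable_kernel]\<close>)
  then show ?thesis using expectation_pair[OF one_two, of "\<lambda>z. kernel z ^ 4"] by simp
qed

lemma kernel_variance_le:
  "(\<integral>z. kernel z * kernel z \<partial>(\<mu> \<Otimes>\<^sub>M \<mu>))\<^sup>2 \<le> ddist_moment4 M p copies"
proof -
  have "(\<integral>z. (kernel z)\<^sup>2 \<partial>(\<mu> \<Otimes>\<^sub>M \<mu>))\<^sup>2 \<le> (\<integral>z. ((kernel z)\<^sup>2)\<^sup>2 \<partial>(\<mu> \<Otimes>\<^sub>M \<mu>))"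
    by (rule mu2.expectation_square_le) (use degenerate_kernelD(1)[OF degenerate_kernel_component] in auto)
  then show ?thesis by (simp add: ddist_moment4_eq power2_eq_square numeral_eq_Suc mult.assoc)
qed

lemma ddist_moment4_bound:
  assumes mean: "\<And>j. j < p \<Longrightarrow> (\<integral>z. \<phi> z j \<partial>\<mu>) = 0" and X0: "X0 \<in> measurable M (vec_borel p)"
    and law: "distr M (vec_borel p) X0 = law" and B: "B_const M p copies > 0"
  shows "ddist_moment4 M p copies \<le> 32768 * L_const M p X0 copies / (B_const M p copies)\<^sup>2"
proof -
  note [measurable] = X0
  have m: "(\<integral>\<omega>. (vnorm p (X0 \<omega>))\<^sup>2 \<partial>M) = (\<integral>x. (vnorm p x)\<^sup>2 \<partial>law)"
    unfolding law[symmetric] by (subst integral_distr) auto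
  have u: "(\<integral>\<omega>. ((vnorm p (X0 \<omega>))\<^sup>2 - c) ^ 4 \<partial>M) = (\<integral>x. ((vnorm p x)\<^sup>2 - c) ^ 4 \<partial>law)" for c
    unfolding law[symmetric] by (subst integral_distr) auto
  have t: "(\<integral>\<omega>. vinner p (copies 1 \<omega>) (copies 2 \<omega>) ^ 4 \<partial>M)
      = (\<integral>z. vinner p (fst z) (snd z) ^ 4 \<partial>(law \<Otimes>\<^sub>M law))"
    using S.expectation_pair[OF one_two, of "\<lambda>z. vinner p (fst z) (snd z) ^ 4"] by simp
  have b: "B_const M p copies = (\<integral>z. (pair_dist p z)\<^sup>2 \<partial>(law \<Otimes>\<^sub>M law))"
    using S.expectation_pair[OF one_two, of "\<lambda>z. (pair_dist p z)\<^sup>2"] by (simp add: B_const_def)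
  have k: "ddist_moment4 M p copies = (\<integral>z. law.dist_kernel z ^ 4 \<partial>(law \<Otimes>\<^sub>M law))"
    using S.expectation_pair[OF one_two, of "\<lambda>z. law.dist_kernel z ^ 4"]
      expectation_pair[OF one_two, of "\<lambda>z. kernel z ^ 4"]
    by (simp add: ddist_moment4_eq kernel_Z)
  have mean': "(\<integral>x. x j \<partial>law) = 0" if "j < p" for j
    using mean[OF that] measurable_vec_component[OF that] by (subst integral_distr) auto
  show ?thesis
    using law.dist_kernel_fourth_bound[OF mean'] B
    unfolding k b L_const_def by (simp add: m u t[unfolded One_nat_def])
qed

end

locale paired_sample =
  X: vec_component M Z \<mu> n fst p + Y: vec_component M Z \<mu> n snd q
  for M :: "'a measure" and Z :: "nat \<Rightarrow> 'a \<Rightarrow> rvec \<times> rvec" and \<mu> n p q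

begin

definition cov :: real where "cov = (\<integral>z. X.kernel z * Y.kernel z \<partial>(\<mu> \<Otimes>\<^sub>M \<mu>))"
definition var_X :: real where "var_X = (\<integral>z. X.kernel z * X.kernel z \<partial>(\<mu> \<Otimes>\<^sub>M \<mu>))"
definition var_Y :: real where "var_Y = (\<integral>z. Y.kernel z * Y.kernel z \<partial>(\<mu> \<Otimes>\<^sub>M \<mu>))"

lemma
  shows dcov2_eq: "dcov2 M p q X.copies Y.copies = cov"
    and dvar2_X: "dvar2 M p X.copies = var_X" and dvar2_Y: "dvar2 M q Y.copies = var_Y"
proof -
  have eq: "(\<integral>\<omega>. f \<omega> * g \<omega> \<partial>M) = (\<integral>z. k z * l z \<partial>(\<mu> \<Otimes>\<^sub>M \<mu>))"
    if f: "AE \<omega> in M. f \<omega> = k (Z 1 \<omega>, Z 2 \<omega>)" and g: "AE \<omega> in M. g \<omega> = l (Z 1 \<omega>, Z 2 \<omega>)"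
      and [measurable]: "f \<in> borel_measurable M" "g \<in> borel_measurable M"
      "k \<in> borel_measurable (\<mu> \<Otimes>\<^sub>M \<mu>)" "l \<in> borel_measurable (\<mu> \<Otimes>\<^sub>M \<mu>)"
    for f g :: "'a \<Rightarrow> real" and k l :: "(rvec \<times> rvec) \<times> (rvec \<times> rvec) \<Rightarrow> real"
  proof -
    have [measurable]: "(\<lambda>\<omega>. k (Z 1 \<omega>, Z 2 \<omega>)) \<in> borel_measurable M" "(\<lambda>\<omega>. l (Z 1 \<omega>, Z 2 \<omega>)) \<in> borel_measurable M"
      by (rule measurable_compose[OF X.measurable_Z_pair[OF X.one_two(1,2)]]; measurable)+
    have "(\<integral>\<omega>. f \<omega> * g \<omega> \<partial>M) = (\<integral>\<omega>. k (Z 1 \<omega>, Z 2 \<omega>) * l (Z 1 \<omega>, Z 2 \<omega>) \<partial>M)"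
    proof (rule integral_cong_AE)
      show "AE \<omega> in M. f \<omega> * g \<omega> = k (Z 1 \<omega>, Z 2 \<omega>) * l (Z 1 \<omega>, Z 2 \<omega>)"
        using f g by eventually_elim simp
    qed measurable
    also have "\<dots> = (\<integral>z. k z * l z \<partial>(\<mu> \<Otimes>\<^sub>M \<mu>))"
      using X.expectation_pair[OF X.one_two, of "\<lambda>z. k z * l z"] by simp
    finally show ?thesis .
  qed
  note x = X.ddist_eq and y = Y.ddist_eq and mx = X.measurable_ddist and my = Y.measurable_ddist
    and kx = X.measurable_kernel and ky = Y.measurable_kernel
  show "dcov2 M p q X.copies Y.copies = cov"
    unfolding dcov2_def cov_def by (rule eq[OF x y mx my kx ky])
  show "dvar2 M p X.copies = var_X"
    unfolding dvar2_def dcov2_def var_X_def by (rule eq[OF x x mx mx kx kx])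
  show "dvar2 M q Y.copies = var_Y"
    unfolding dvar2_def dcov2_def var_Y_def by (rule eq[OF y y my my ky ky])
qed

section \<open>The statistic in terms of the kernels\<close>

definition sample_cov :: "'a \<Rightarrow> real" where
  "sample_cov \<omega> = sample_dcov n (\<lambda>k l. X.kernel_at X.kernel k l \<omega>) (\<lambda>k l. X.kernel_at Y.kernel k l \<omega>)"
definition sample_var_X :: "'a \<Rightarrow> real" where
  "sample_var_X \<omega> = sample_dcov n (\<lambda>k l. X.kernel_at X.kernel k l \<omega>) (\<lambda>k l. X.kernel_at X.kernel k l \<omega>)"
definition sample_var_Y :: "'a \<Rightarrow> real" where
  "sample_var_Y \<omega> = sample_dcov n (\<lambda>k l. X.kernel_at Y.kernel k l \<omega>) (\<lambda>k l. X.kernel_at Y.kernel k l \<omega>)"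

lemma T_stat_eq:
  "T_stat n p q X.copies Y.copies \<omega> = sqrt (real n * (real n - 1) / 2) *
     (if sample_var_X \<omega> * sample_var_Y \<omega> > 0
      then sample_cov \<omega> / sqrt (sample_var_X \<omega> * sample_var_Y \<omega>) else 0)"
proof -
  let ?a = "\<lambda>k l. vdist p (X.copies k \<omega>) (X.copies l \<omega>)" and ?b = "\<lambda>k l. vdist q (Y.copies k \<omega>) (Y.copies l \<omega>)"
  note c = sample_dcov_double_centering[OF X.n4 vdist_commute vdist_commute vdist_self vdist_self]
  have "sample_dcov n ?a ?b = sample_cov \<omega>" "sample_dcov n ?a ?a = sample_var_X \<omega>"
    "sample_dcov n ?b ?b = sample_var_Y \<omega>"
    unfolding sample_cov_def sample_var_X_def sample_var_Y_def
    by (rule c[OF X.kernel_at_eq Y.kernel_at_eq] c[OF X.kernel_at_eq X.kernel_at_eq]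
        c[OF Y.kernel_at_eq Y.kernel_at_eq])+
  then show ?thesis by (simp add: T_stat_def sample_dcor_def)
qed

text \<open>The prefactor is at least n/2, the numerator at least half its target and the root in
  the denominator at most 3/2 of its target: (1/2)(1/2)/(3/2) = 1/6. Both sample variances are
  positive, so the default value 0 is avoided.\<close>

lemma T_stat_ge:
  assumes pos: "cov > 0" "var_X > 0" "var_Y > 0"
    and dev: "\<bar>sample_cov \<omega> - cov\<bar> < cov / 2" "\<bar>sample_var_X \<omega> - var_X\<bar> < var_X / 2"
      "\<bar>sample_var_Y \<omega> - var_Y\<bar> < var_Y / 2"
  shows "real n * (cov / sqrt (var_X * var_Y)) / 6 \<le> T_stat n p q X.copies Y.copies \<omega>"
proof -
  have V: "cov / 2 \<le> sample_cov \<omega>" and Vx: "0 < sample_var_X \<omega>" "sample_var_X \<omega> \<le> 3 / 2 * var_X"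
    and Vy: "0 < sample_var_Y \<omega>" "sample_var_Y \<omega> \<le> 3 / 2 * var_Y"
    using dev pos unfolding abs_less_iff by linarith+
  have n: "real n / 2 \<le> sqrt (real n * (real n - 1) / 2)"
  proof (rule real_le_rsqrt)
    have "(real n / 2)\<^sup>2 = real n * (real n / 4)" by (simp add: power2_eq_square)
    also have "\<dots> \<le> real n * ((real n - 1) / 2)"
      using X.n4 by (intro mult_left_mono) auto
    finally show "(real n / 2)\<^sup>2 \<le> real n * (real n - 1) / 2" by simp
  qed
  have "sqrt (sample_var_X \<omega> * sample_var_Y \<omega>) \<le> sqrt ((3 / 2)\<^sup>2 * (var_X * var_Y))"
  proof (rule real_sqrt_le_mono)
    have "sample_var_X \<omega> * sample_var_Y \<omega> \<le> (3 / 2 * var_X) * (3 / 2 * var_Y)"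
      using Vx Vy pos by (intro mult_mono) auto
    then show "sample_var_X \<omega> * sample_var_Y \<omega> \<le> (3 / 2)\<^sup>2 * (var_X * var_Y)"
      by (simp add: power2_eq_square mult_ac)
  qed
  also have "\<dots> = 3 / 2 * sqrt (var_X * var_Y)"
    by (subst real_sqrt_mult) simp
  finally have den: "sqrt (sample_var_X \<omega> * sample_var_Y \<omega>) \<le> 3 / 2 * sqrt (var_X * var_Y)" .
  have r: "0 < sqrt (sample_var_X \<omega> * sample_var_Y \<omega>)" using Vx Vy by simp
  have "real n * (cov / sqrt (var_X * var_Y)) / 6 = real n / 2 * ((cov / 2) / (3 / 2 * sqrt (var_X * var_Y)))"
    by simp
  also have "\<dots> \<le> sqrt (real n * (real n - 1) / 2) * (sample_cov \<omega> / sqrt (sample_var_X \<omega> * sample_var_Y \<omega>))"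
    using n V den r pos X.n4 by (intro mult_mono frac_le) auto
  finally show ?thesis using Vx Vy by (simp add: T_stat_eq)
qed

text \<open>By \<open>T_stat_ge\<close> failure forces one of three deviations by half the target; a
  union bound applies, and the halved tolerance doubles 28 to 56.\<close>

lemma prob_T_stat_gt:
  assumes pos: "cov > 0" "var_X > 0" "var_Y > 0"
    and C: "C < real n * (cov / sqrt (var_X * var_Y)) / 6"
    and a: "a > 0" "ddist_moment4 M p X.copies = a ^ 4" and b: "b > 0" "ddist_moment4 M q Y.copies = b ^ 4"
  shows "\<P>(\<omega> in M. T_stat n p q X.copies Y.copies \<omega> > C)
    \<ge> 1 - 56 * (a * b / (sqrt (real n) * cov) + a\<^sup>2 / (sqrt (real n) * var_X) + b\<^sup>2 / (sqrt (real n) * var_Y))"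
proof -
  note hx = X.degenerate_kernel_component a(2)[unfolded X.ddist_moment4_eq] a(1)
  note hy = Y.degenerate_kernel_component b(2)[unfolded Y.ddist_moment4_eq] b(1)
  note dev = X.prob_sample_dcov_deviation[OF hx hy X.n4, of "cov / 2", folded cov_def sample_cov_def]
    X.prob_sample_dcov_deviation[OF hx hx X.n4, of "var_X / 2", folded var_X_def sample_var_X_def]
    X.prob_sample_dcov_deviation[OF hy hy X.n4, of "var_Y / 2", folded var_Y_def sample_var_Y_def]
  have [measurable]: "sample_cov \<in> borel_measurable M" "sample_var_X \<in> borel_measurable M" "sample_var_Y \<in> borel_measurable M"
    using X.integrable_sample_dcov[OF hx hy X.n4] X.integrable_sample_dcov[OF hx hx X.n4]
      X.integrable_sample_dcov[OF hy hy X.n4]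
    by (auto simp: sample_cov_def[abs_def] sample_var_X_def[abs_def] sample_var_Y_def[abs_def])
  have [measurable]: "T_stat n p q X.copies Y.copies \<in> borel_measurable M"
    unfolding T_stat_eq[abs_def] by measurable
  define A1 where "A1 = {\<omega>\<in>space M. cov / 2 \<le> \<bar>sample_cov \<omega> - cov\<bar>}"
  define A2 where "A2 = {\<omega>\<in>space M. var_X / 2 \<le> \<bar>sample_var_X \<omega> - var_X\<bar>}"
  define A3 where "A3 = {\<omega>\<in>space M. var_Y / 2 \<le> \<bar>sample_var_Y \<omega> - var_Y\<bar>}"
  define G where "G = {\<omega>\<in>space M. T_stat n p q X.copies Y.copies \<omega> > C}"
  have ev: "A1 \<in> X.events" "A2 \<in> X.events" "A3 \<in> X.events" "G \<in> X.events"
    unfolding A1_def A2_def A3_def G_def by measurable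
  have "space M - G \<subseteq> A1 \<union> A2 \<union> A3"
  proof (rule subsetI, rule ccontr)
    fix \<omega> assume "\<omega> \<in> space M - G" and "\<omega> \<notin> A1 \<union> A2 \<union> A3"
    then have "\<not> C < T_stat n p q X.copies Y.copies \<omega>" "\<bar>sample_cov \<omega> - cov\<bar> < cov / 2"
      "\<bar>sample_var_X \<omega> - var_X\<bar> < var_X / 2" "\<bar>sample_var_Y \<omega> - var_Y\<bar> < var_Y / 2"
      unfolding A1_def A2_def A3_def G_def Un_iff Diff_iff mem_Collect_eq de_Morgan_disj not_le[symmetric]
      by blast+
    with T_stat_ge[OF pos, of \<omega>] C show False by linarith
  qed
  then have "X.prob (space M - G) \<le> X.prob (A1 \<union> A2 \<union> A3)"
    using ev by (intro X.finite_measure_mono) auto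
  also have "\<dots> \<le> X.prob A1 + X.prob A2 + X.prob A3"
    using ev by (intro order_trans[OF measure_Un_le] add_right_mono measure_Un_le) auto
  also have "\<dots> \<le> 28 * (a * b) / (sqrt (real n) * (cov / 2)) + 28 * (a * a) / (sqrt (real n) * (var_X / 2))
      + 28 * (b * b) / (sqrt (real n) * (var_Y / 2))"
    unfolding A1_def A2_def A3_def using pos by (intro add_mono dev) auto
  also have "\<dots> = 56 * (a * b / (sqrt (real n) * cov) + a\<^sup>2 / (sqrt (real n) * var_X) + b\<^sup>2 / (sqrt (real n) * var_Y))"
    by (simp add: power2_eq_square distrib_left)
  finally show ?thesis
    using X.prob_compl[OF ev(4)] by (simp add: G_def)
qed

end

section \<open>Consistency of the test\<close>

lemma paired_sample_iid_copies:
  fixes X Y :: "'a \<Rightarrow> rvec" and Xs Ys :: "nat \<Rightarrow> 'a \<Rightarrow> rvec"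
  assumes "prob_space M" and n: "n \<ge> 4"
    and X [measurable]: "X \<in> measurable M (vec_borel p)" and Y [measurable]: "Y \<in> measurable M (vec_borel q)"
    and iid: "iid_copies M (vec_borel p \<Otimes>\<^sub>M vec_borel q) (\<lambda>\<omega>. (X \<omega>, Y \<omega>)) {1..n} (\<lambda>i \<omega>. (Xs i \<omega>, Ys i \<omega>))"
    and moments: "integrable M (\<lambda>\<omega>. vnorm p (X \<omega>) ^ 8)" "integrable M (\<lambda>\<omega>. vnorm q (Y \<omega>) ^ 8)"
  shows "paired_sample M (\<lambda>i \<omega>. (Xs i \<omega>, Ys i \<omega>))
    (distr M (vec_borel p \<Otimes>\<^sub>M vec_borel q) (\<lambda>\<omega>. (X \<omega>, Y \<omega>))) n p q"
proof -
  interpret prob_space M by fact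
  let ?N = "vec_borel p \<Otimes>\<^sub>M vec_borel q"
  let ?Z = "\<lambda>i \<omega>. (Xs i \<omega>, Ys i \<omega>)"
  let ?\<mu> = "distr M ?N (\<lambda>\<omega>. (X \<omega>, Y \<omega>))"
  have "indep_vars (\<lambda>_. ?\<mu>) ?Z {1..n}"
    using iid by (simp add: iid_copies_def indep_vars_def2)
  moreover have "distr M ?\<mu> (?Z i) = ?\<mu>" if "i \<in> {1..n}" for i
    using iid that distr_cong[of M M ?\<mu> ?N "?Z i" "?Z i"] by (simp add: iid_copies_def)
  moreover have "prob_space ?\<mu>" by (rule prob_space_distr) measurable
  ultimately have s: "iid_sample M ?Z ?\<mu> n"
    by (intro iid_sample.intro iid_sample_axioms.intro prob_space_axioms)
  have "integrable ?\<mu> (\<lambda>z. vnorm p (fst z) ^ 8)" "integrable ?\<mu> (\<lambda>z. vnorm q (snd z) ^ 8)"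
    using moments by (simp_all add: integrable_distr_eq)
  then show ?thesis
    using s n by (auto intro!: paired_sample.intro vec_component.intro vec_component_axioms.intro)
qed

text \<open>14 is the least integer whose fourth power, 38416, reaches 32768.\<close>

lemma fourth_root_bound:
  fixes m B L :: real
  assumes "m \<ge> 0" "B > 0" "L \<ge> 0" "m \<le> 32768 * L / B\<^sup>2"
  shows "m powr (1 / 4) \<le> 14 * (B powr (- 1 / 2) * L powr (1 / 4))"
proof -
  have r4: "(x powr (1 / 4)) ^ 4 = x" if "x \<ge> 0" for x :: real
    using that by (cases "x = 0") (simp_all add: powr_power)
  have "(14 * (B powr (- 1 / 2) * L powr (1 / 4))) ^ 4 = 38416 * (B powr (- 2) * L)"
    using assms r4[of L] by (simp add: power_mult_distrib powr_power)
  also have "B powr (- 2) = 1 / B\<^sup>2"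
    using assms(2) by (simp add: powr_minus_divide powr_numeral)
  finally have "(14 * (B powr (- 1 / 2) * L powr (1 / 4))) ^ 4 = 38416 * L / B\<^sup>2" by simp
  moreover have "(m powr (1 / 4)) ^ 4 = m" by (rule r4[OF assms(1)])
  moreover have "32768 * L / B\<^sup>2 \<le> 38416 * L / B\<^sup>2"
    using assms by (intro divide_right_mono mult_right_mono) auto
  ultimately have "(m powr (1 / 4)) ^ Suc 3 \<le> (14 * (B powr (- 1 / 2) * L powr (1 / 4))) ^ Suc 3"
    using assms(4) by simp
  then show ?thesis by (rule power_le_imp_le_base) simp
qed

text \<open>The whole theorem at a fixed n: the error terms are the reciprocal of the second signal
  ratio, with 196 = 14^2 from one fourth root per component, and twice the root of the moment ratio,
  once per variance.\<close>

lemma prob_T_stat_gt_ge: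
  fixes M :: "'a measure" and n p q :: nat and X Y :: "'a \<Rightarrow> rvec" and Xs Ys :: "nat \<Rightarrow> 'a \<Rightarrow> rvec"
  defines "v \<equiv> dcov2 M p q Xs Ys"
    and "D \<equiv> B_const M p Xs powr (- 1 / 2) * B_const M q Ys powr (- 1 / 2) *
            L_const M p X Xs powr (1 / 4) * L_const M q Y Ys powr (1 / 4)"
    and "\<rho> \<equiv> ddist_moment4 M p Xs * ddist_moment4 M q Ys / (real n * (dvar2 M p Xs * dvar2 M q Ys)\<^sup>2)"
  assumes prob: "prob_space M" and n: "n \<ge> 4"
    and X: "X \<in> measurable M (vec_borel p)" and Y: "Y \<in> measurable M (vec_borel q)"
    and iid: "iid_copies M (vec_borel p \<Otimes>\<^sub>M vec_borel q) (\<lambda>\<omega>. (X \<omega>, Y \<omega>)) {1..n} (\<lambda>i \<omega>. (Xs i \<omega>, Ys i \<omega>))"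
    and moments: "integrable M (\<lambda>\<omega>. vnorm p (X \<omega>) ^ 8)" "integrable M (\<lambda>\<omega>. vnorm q (Y \<omega>) ^ 8)"
    and X_mean: "\<And>j. j < p \<Longrightarrow> (\<integral>\<omega>. X \<omega> j \<partial>M) = 0" and Y_mean: "\<And>j. j < q \<Longrightarrow> (\<integral>\<omega>. Y \<omega> j \<partial>M) = 0"
    and dvar: "dvar2 M p Xs > 0" "dvar2 M q Ys > 0"
    and Q: "sqrt (real n) * v / D > 0"
    and C: "C < real n * dcor2 M p q Xs Ys / 6"
  shows "\<P>(\<omega> in M. T_stat n p q Xs Ys \<omega> > C) \<ge> 1 - 56 * (196 / (sqrt (real n) * v / D) + 2 * sqrt \<rho>)"
proof -
  let ?N = "vec_borel p \<Otimes>\<^sub>M vec_borel q"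
  let ?\<mu> = "distr M ?N (\<lambda>\<omega>. (X \<omega>, Y \<omega>))"
  note [measurable] = X Y
  interpret S: paired_sample M "\<lambda>i \<omega>. (Xs i \<omega>, Ys i \<omega>)" ?\<mu> n p q
    by (rule paired_sample_iid_copies[OF prob n X Y iid moments])
  have cX: "S.X.copies = Xs" and cY: "S.Y.copies = Ys"
    by (simp_all add: S.X.copies_def S.Y.copies_def fun_eq_iff)
  define a where "a = ddist_moment4 M p Xs powr (1 / 4)"
  define b where "b = ddist_moment4 M q Ys powr (1 / 4)"
  have vx: "dvar2 M p Xs = S.var_X" and vy: "dvar2 M q Ys = S.var_Y" and v: "v = S.cov"
    using S.dvar2_X S.dvar2_Y S.dcov2_eq by (simp_all add: cX cY v_def)
  have pos: "S.var_X > 0" "S.var_Y > 0" using dvar by (simp_all add: vx vy)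
  have mx: "S.var_X\<^sup>2 \<le> ddist_moment4 M p Xs" and my: "S.var_Y\<^sup>2 \<le> ddist_moment4 M q Ys"
    using S.X.kernel_variance_le S.Y.kernel_variance_le by (simp_all add: cX cY S.var_X_def S.var_Y_def)
  have m0: "ddist_moment4 M p Xs > 0" "ddist_moment4 M q Ys > 0"
    using mx my pos by (auto intro: less_le_trans[OF zero_less_power])
  then have ab: "a > 0" "b > 0" "ddist_moment4 M p Xs = a ^ 4" "ddist_moment4 M q Ys = b ^ 4"
    by (simp_all add: a_def b_def powr_power)
  have B0: "B_const M p Xs \<ge> 0" "B_const M q Ys \<ge> 0" by (simp_all add: B_const_def)
  have L0: "L_const M p X Xs \<ge> 0" "L_const M q Y Ys \<ge> 0" by (simp_all add: L_const_def)
  \<comment> \<open>Division by 0 yields 0, so a positive ratio excludes \<open>D\<close> = 0; since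
    0 powr any exponent is 0, it also forces both B constants to be positive.\<close>
  have D0: "D \<noteq> 0" using Q by auto
  moreover have "D \<ge> 0" by (simp add: D_def)
  ultimately have D: "D > 0" by simp
  have Bpos: "B_const M p Xs > 0" "B_const M q Ys > 0"
    using D0 B0 unfolding D_def by (auto simp: less_le)
  have vpos: "S.cov > 0"
    using Q D n by (simp add: zero_less_divide_iff zero_less_mult_iff v)
  have law: "distr M (vec_borel p) X = S.X.law" "distr M (vec_borel q) Y = S.Y.law"
    by (subst distr_distr; simp add: comp_def)+
  have mean: "(\<integral>z. fst z j \<partial>?\<mu>) = 0" if "j < p" for j
    using X_mean[OF that] measurable_vec_component[OF that] by (subst integral_distr) auto
  have mean': "(\<integral>z. snd z j \<partial>?\<mu>) = 0" if "j < q" for j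
    using Y_mean[OF that] measurable_vec_component[OF that] by (subst integral_distr) auto
  have "a \<le> 14 * (B_const M p Xs powr (- 1 / 2) * L_const M p X Xs powr (1 / 4))"
    unfolding a_def using S.X.ddist_moment4_bound[OF mean X law(1)] Bpos(1) m0(1) L0(1)
    by (intro fourth_root_bound) (simp_all add: cX)
  moreover have "b \<le> 14 * (B_const M q Ys powr (- 1 / 2) * L_const M q Y Ys powr (1 / 4))"
    unfolding b_def using S.Y.ddist_moment4_bound[OF mean' Y law(2)] Bpos(2) m0(2) L0(2)
    by (intro fourth_root_bound) (simp_all add: cY)
  ultimately have "a * b \<le> (14 * (B_const M p Xs powr (- 1 / 2) * L_const M p X Xs powr (1 / 4))) *
      (14 * (B_const M q Ys powr (- 1 / 2) * L_const M q Y Ys powr (1 / 4)))"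
    using ab by (intro mult_mono) auto
  also have "\<dots> = 196 * D" by (simp add: D_def)
  finally have "a * b / (sqrt (real n) * S.cov) \<le> 196 * D / (sqrt (real n) * S.cov)"
    using vpos by (intro divide_right_mono) auto
  then have e1: "a * b / (sqrt (real n) * S.cov) \<le> 196 / (sqrt (real n) * v / D)"
    by (simp add: v)
  \<comment> \<open>Expanding the fraction by w'^2 and replacing it with the larger m turns the
    ratio of one component into the product ratio of both; this is how a condition on the product
    controls each variance.\<close>
  have ratio: "c\<^sup>2 / (sqrt (real n) * w) \<le> sqrt (c ^ 4 * m / (real n * (w * w')\<^sup>2))"
    if "w > 0" "w' > 0" "w'\<^sup>2 \<le> m" for c w w' m :: real
  proof (rule real_le_rsqrt)
    have "(c\<^sup>2 / (sqrt (real n) * w))\<^sup>2 = c ^ 4 / (real n * w\<^sup>2)"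
      by (simp add: power_divide power_mult_distrib)
    also have "\<dots> = c ^ 4 * w'\<^sup>2 / (real n * (w * w')\<^sup>2)"
      using that by (simp add: power_mult_distrib)
    also have "\<dots> \<le> c ^ 4 * m / (real n * (w * w')\<^sup>2)"
      using that by (intro divide_right_mono mult_left_mono) auto
    finally show "(c\<^sup>2 / (sqrt (real n) * w))\<^sup>2 \<le> c ^ 4 * m / (real n * (w * w')\<^sup>2)" .
  qed
  have e2: "a\<^sup>2 / (sqrt (real n) * S.var_X) \<le> sqrt \<rho>"
    using ratio[OF pos my, of a] by (simp add: \<rho>_def ab vx vy)
  have e3: "b\<^sup>2 / (sqrt (real n) * S.var_Y) \<le> sqrt \<rho>"
    using ratio[OF pos(2,1) mx, of b] by (simp add: \<rho>_def ab vx vy mult.commute)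
  have "1 - 56 * (196 / (sqrt (real n) * v / D) + 2 * sqrt \<rho>)
      \<le> 1 - 56 * (a * b / (sqrt (real n) * S.cov) + a\<^sup>2 / (sqrt (real n) * S.var_X) + b\<^sup>2 / (sqrt (real n) * S.var_Y))"
  proof -
    have "1 - 56 * (x' + 2 * s) \<le> 1 - 56 * (x + y + z)" if "x \<le> x'" "y \<le> s" "z \<le> s" for x x' y z s :: real
      using that by simp
    then show ?thesis using e1 e2 e3 by blast
  qed
  also have "\<dots> \<le> \<P>(\<omega> in M. T_stat n p q Xs Ys \<omega> > C)"
    using S.prob_T_stat_gt[OF vpos pos _ ab(1) _ ab(2), of C] ab(3,4) C
    by (simp add: cX cY dcor2_def vx vy flip: v v_def)
  finally show ?thesis .
qed

theorem theorem5:
  fixes M :: "nat \<Rightarrow> 'a measure"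
    and p q :: "nat \<Rightarrow> nat"
    and X Y :: "nat \<Rightarrow> 'a \<Rightarrow> rvec"
    and Xs Ys :: "nat \<Rightarrow> nat \<Rightarrow> 'a \<Rightarrow> rvec"
  assumes prob: "\<And>n. n \<ge> 4 \<Longrightarrow> prob_space (M n)"
    and X_meas: "\<And>n. n \<ge> 4 \<Longrightarrow> X n \<in> measurable (M n) (vec_borel (p n))"
    and Y_meas: "\<And>n. n \<ge> 4 \<Longrightarrow> Y n \<in> measurable (M n) (vec_borel (q n))"
    and iid: "\<And>n. n \<ge> 4 \<Longrightarrow>
      iid_copies (M n) (vec_borel (p n) \<Otimes>\<^sub>M vec_borel (q n))
        (\<lambda>\<omega>. (X n \<omega>, Y n \<omega>)) {1..n} (\<lambda>i \<omega>. (Xs n i \<omega>, Ys n i \<omega>))"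
    and X_moment: "\<And>n. n \<ge> 4 \<Longrightarrow> integrable (M n) (\<lambda>\<omega>. vnorm (p n) (X n \<omega>) ^ 8)"
    and Y_moment: "\<And>n. n \<ge> 4 \<Longrightarrow> integrable (M n) (\<lambda>\<omega>. vnorm (q n) (Y n \<omega>) ^ 8)"
    and X_mean: "\<And>n j. n \<ge> 4 \<Longrightarrow> j < p n \<Longrightarrow> (\<integral>\<omega>. X n \<omega> j \<partial>M n) = 0"
    and Y_mean: "\<And>n j. n \<ge> 4 \<Longrightarrow> j < q n \<Longrightarrow> (\<integral>\<omega>. Y n \<omega> j \<partial>M n) = 0"
    and X_dvar: "\<And>n. n \<ge> 4 \<Longrightarrow> dvar2 (M n) (p n) (Xs n) > 0"
    and Y_dvar: "\<And>n. n \<ge> 4 \<Longrightarrow> dvar2 (M n) (q n) (Ys n) > 0"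
    and moment_ratio:
      "(\<lambda>n. ddist_moment4 (M n) (p n) (Xs n) * ddist_moment4 (M n) (q n) (Ys n) /
            (real n * (dvar2 (M n) (p n) (Xs n) * dvar2 (M n) (q n) (Ys n))\<^sup>2))
         \<longlonglongrightarrow> 0"
    and signal:
      "filterlim (\<lambda>n. real n * dcor2 (M n) (p n) (q n) (Xs n) (Ys n)) at_top sequentially"
    and signal':
      "filterlim (\<lambda>n. sqrt (real n) * dcov2 (M n) (p n) (q n) (Xs n) (Ys n) /
           (B_const (M n) (p n) (Xs n) powr (- 1 / 2) * B_const (M n) (q n) (Ys n) powr (- 1 / 2) *
            L_const (M n) (p n) (X n) (Xs n) powr (1 / 4) *
            L_const (M n) (q n) (Y n) (Ys n) powr (1 / 4)))
         at_top sequentially"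
  shows "(\<forall>C>0. (\<lambda>n. \<P>(\<omega> in M n. T_stat n (p n) (q n) (Xs n) (Ys n) \<omega> > C)) \<longlonglongrightarrow> 1) \<and>
    (\<forall>\<alpha>\<in>{0<..<1}. (\<lambda>n. \<P>(\<omega> in M n. T_stat n (p n) (q n) (Xs n) (Ys n) \<omega> >
        std_normal_quantile (1 - \<alpha>))) \<longlonglongrightarrow> 1)"
proof -
  \<comment> \<open>C ranges over all reals, so the normal quantile, possibly negative, is one of
    its values.\<close>
  have "(\<lambda>n. \<P>(\<omega> in M n. T_stat n (p n) (q n) (Xs n) (Ys n) \<omega> > C)) \<longlonglongrightarrow> 1" for C
  proof (rule tendsto_sandwich[OF _ _ _ tendsto_const])
    let ?Q = "\<lambda>n. sqrt (real n) * dcov2 (M n) (p n) (q n) (Xs n) (Ys n) /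
           (B_const (M n) (p n) (Xs n) powr (- 1 / 2) * B_const (M n) (q n) (Ys n) powr (- 1 / 2) *
            L_const (M n) (p n) (X n) (Xs n) powr (1 / 4) *
            L_const (M n) (q n) (Y n) (Ys n) powr (1 / 4))"
    let ?\<rho> = "\<lambda>n. ddist_moment4 (M n) (p n) (Xs n) * ddist_moment4 (M n) (q n) (Ys n) /
            (real n * (dvar2 (M n) (p n) (Xs n) * dvar2 (M n) (q n) (Ys n))\<^sup>2)"
    have "((\<lambda>n. 196 / ?Q n) \<longlonglongrightarrow> 0)"
      by (rule real_tendsto_divide_at_top[OF tendsto_const signal'])
    moreover have "(\<lambda>n. sqrt (?\<rho> n)) \<longlonglongrightarrow> 0"
      using tendsto_real_sqrt[OF moment_ratio] by simp
    ultimately have "(\<lambda>n. 1 - 56 * (196 / ?Q n + 2 * sqrt (?\<rho> n))) \<longlonglongrightarrow> 1 - 56 * (0 + 2 * 0)"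
      by (intro tendsto_intros)
    then show "(\<lambda>n. 1 - 56 * (196 / ?Q n + 2 * sqrt (?\<rho> n))) \<longlonglongrightarrow> 1" by simp
    \<comment> \<open>Positivity of the ratio and n R^2 > 6 C are the two hypotheses of the fixed-n
      bound that hold only for large n.\<close>
    have "eventually (\<lambda>n. ?Q n > 0) sequentially"
      using signal' by (simp add: filterlim_at_top_dense)
    moreover have "eventually (\<lambda>n. real n * dcor2 (M n) (p n) (q n) (Xs n) (Ys n) > 6 * C) sequentially"
      using signal by (simp add: filterlim_at_top_dense)
    moreover have "eventually (\<lambda>n::nat. n \<ge> 4) sequentially" by (rule eventually_ge_at_top)
    ultimately show "eventually (\<lambda>n. 1 - 56 * (196 / ?Q n + 2 * sqrt (?\<rho> n))
        \<le> \<P>(\<omega> in M n. T_stat n (p n) (q n) (Xs n) (Ys n) \<omega> > C)) sequentially"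
    proof eventually_elim
      case (elim n)
      show ?case
        by (rule prob_T_stat_gt_ge[OF prob elim(3) X_meas Y_meas iid X_moment Y_moment X_mean Y_mean X_dvar Y_dvar elim(1)])
           (use elim in auto)
    qed
    show "eventually (\<lambda>n. \<P>(\<omega> in M n. T_stat n (p n) (q n) (Xs n) (Ys n) \<omega> > C) \<le> 1) sequentially"
      using eventually_ge_at_top[of 4] by eventually_elim (use prob prob_space.prob_le_1 in blast)
  qed
  then show ?thesis by simp
qed

end
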